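(* Let $N$ be an ordered negative support family for $\mathbf v_0$, let $\phi_N(\mathbf x)=\sum_{\mathbf u\in L,\,I_{\mathbf u}\in N}\mathbf x^{\mathbf v_0+\mathbf u}r_{\mathbf u}(\log\mathbf x)$ with $r_{\mathbf u}\in\mathbb C[\mathbf y]$ (and $r_{\mathbf u}=0$ if $I_{\mathbf u}\in N^c$), and let $c_{\mathbf u}$ ($\mathbf u\in L$) be its normalized coefficients $$c_{\mathbf u}=\bigl(\widetilde d_{\mathbf u\leftarrow\mathbf 0}\bullet\bigr)^{-1}\bigl(\widetilde d_{\mathbf 0\leftarrow\mathbf u}\bullet r_{\mathbf u}\bigr).$$ Then $\phi_N(\mathbf x)$ is annihilated by $H_A(\boldsymbol\beta)$ if and only if the following two conditions hold. (1) For any $\mathbf u,\mathbf u'\in L$, the equality $I_{\mathbf u}=I_{\mathbf u'}$ implies $c_{\mathbf u}=c_{\mathbf u'}$. (Thus one may write $c_I:=c_{\mathbf u}$ if $I=I_{\mathbf u}\in\mathrm{NS}$; in particular $c_I=0$ for $I\in N^c$.) (2) The family $(c_I)_{I\in\mathrm{NS}}$ satisfies $$\Bigl(\sum_{j=1}^n a_{ij}\partial_{y_j}\Bigr)\bullet c_I=0\quad(I\in\mathrm{NS},\ i=1,\dots,d),$$ $$\partial_{\mathbf y}^{I'\setminus I}\bullet c_I-\partial_{\mathbf y}^{I\setminus I'}\bullet c_{I'}=0\quad(I,I'\in\mathrm{NS}).$$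
   Context: $\mathbb N$ is the set of nonnegative integers. Let $A=(\mathbf a_1,\dots,\mathbf a_n)=(a_{ij})$ be a $d\times n$ integer matrix of rank $d$ whose columns all lie in a single affine hyperplane of $\mathbb Q^d$ not passing through the origin. Put $L=\operatorname{Ker}_{\mathbb Z}(A)\subset\mathbb Z^n$. The toric ideal is $I_A=\langle\partial_{\mathbf x}^{\mathbf u}-\partial_{\mathbf x}^{\mathbf v}\mid A\mathbf u=A\mathbf v,\ \mathbf u,\mathbf v\in\mathbb N^n\rangle\subset\mathbb C[\partial_1,\dots,\partial_n]$. For $\boldsymbol\beta\in\mathbb C^d$, $H_A(\boldsymbol\beta)$ is the left ideal of the Weyl algebra $D$ in $x_j,\partial_j$ generated by $I_A$ and the Euler operators $\sum_j a_{ij}\theta_j-\beta_i$ ($1\le i\le d$), $\theta_j=x_j\partial_j$; it acts termwise on formal logarithmic series. Fix a generic weight $\mathbf w\in\mathbb R^n$, i.e. such that $\operatorname{in}_{\mathbf w}(I_A)$ (generated by the parts of maximal $\mathbf w$-weight of elements of $I_A$) is a monomial ideal, and a fake exponent $\mathbf v_0\in\mathbb C^n$ of $H_A(\boldsymbol\beta)$ with respect to $\mathbf w$, i.e. a zero of $(D\operatorname{in}_{\mathbf w}(I_A)\cap\mathbb C[\boldsymbol\theta])+\langle A\boldsymbol\theta-\boldsymbol\beta\rangle\subset\mathbb C[\boldsymbol\theta]$. For $\mathbf u\in L$ put $I_{\mathbf u}=\{j\mid(\mathbf v_0+\mathbf u)_j\in\mathbb Z_{<0}\}$; put $\mathrm{NS}=\{I_{\mathbf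 u}\mid\mathbf u\in L\}$ and $\mathcal N_{\mathbf v_0}=\{I\in\mathrm{NS}\mid \mathbf w\cdot\mathbf u\ge0\text{ for every }\mathbf u\in L\text{ with }I_{\mathbf u}=I\}$. A negative support family for $\mathbf v_0$ is a set $N$ with $I_{\mathbf 0}\in N\subset\mathcal N_{\mathbf v_0}$; it is ordered if $I\in N$, $J\in\mathrm{NS}$, $J\subset I$ imply $J\in N$. Put $N^c=\mathrm{NS}\setminus N$. $\mathbf y=(y_1,\dots,y_n)$ are variables representing $\log\mathbf x=(\log x_1,\dots,\log x_n)$; $\bullet$ is the usual action of $\mathbb C[\partial_{\mathbf y}]$ on $\mathbb C[\mathbf y]$; $\partial_{\mathbf y}^S=\prod_{j\in S}\partial_{y_j}$ (empty product $=1$). For $\mathbf u,\mathbf u'\in L$ define $$d_{\mathbf u'\leftarrow\mathbf u}=\prod_{\nu=1}^n\prod_{\mu=1}^{u_\nu-u'_\nu}\bigl(\partial_{y_\nu}+(\mathbf v_0)_\nu+u_\nu-\mu+1\bigr)\in\mathbb C[\partial_{\mathbf y}],$$ the inner product being $1$ if $u_\nu-u'_\nu\le0$. There is a unique $\widetilde d_{\mathbf u'\leftarrow\mathbf u}\in\mathbb C[\partial_{\mathbf y}]$ with nonzero constant term such that $d_{\mathbf u'\leftarrow\mathbf u}=\widetilde d_{\mathbf u'\leftarrow\mathbf u}\,\partial_{\mathbf y}^{I_{\mathbf u'}\setminus I_{\mathbf u}}$, and $\widetilde d_{\mathbf u'\leftarrow\mathbf u}\bullet:\mathbb C[\mathbf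 y]\to\mathbb C[\mathbf y]$ is a $\mathbb C$-linear automorphism. *)

theory Defs
  imports "HOL-Analysis.Analysis" "HOL-Library.Poly_Mapping"
begin

abbreviation lookup :: "('a \<Rightarrow>\<^sub>0 'b::zero) \<Rightarrow> 'a \<Rightarrow> 'b"
  where "lookup \<equiv> Poly_Mapping.lookup"

abbreviation keys :: "('a \<Rightarrow>\<^sub>0 'b::zero) \<Rightarrow> 'a set"
  where "keys \<equiv> Poly_Mapping.keys"

abbreviation single :: "'a \<Rightarrow> 'b \<Rightarrow> ('a \<Rightarrow>\<^sub>0 'b::zero)"
  where "single \<equiv> Poly_Mapping.single"


section \<open>Ideals\<close>

text \<open>The ideals generated by a set \<open>S\<close> are \<open>left_ideal hull S\<close> and \<open>two_sided_ideal hull S\<close>.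
  In a commutative ring a left ideal is just an ideal.\<close>

definition left_ideal :: "'a::ring_1 set \<Rightarrow> bool"
  where "left_ideal J \<longleftrightarrow> 0 \<in> J \<and> (\<forall>f\<in>J. \<forall>g\<in>J. f + g \<in> J) \<and> (\<forall>h. \<forall>f\<in>J. h * f \<in> J)"

definition two_sided_ideal :: "'a::ring_1 set \<Rightarrow> bool"
  where "two_sided_ideal J \<longleftrightarrow> left_ideal J \<and> (\<forall>h. \<forall>f\<in>J. f * h \<in> J)"

lemma left_ideal_hull: "left_ideal (left_ideal hull S)"
  by (rule hull_in) (auto simp: left_ideal_def)

lemma two_sided_ideal_hull: "two_sided_ideal (two_sided_ideal hull S)"
  by (rule hull_in) (auto simp: two_sided_ideal_def left_ideal_def)

lemma two_sided_idealD:
  assumes "two_sided_ideal J"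
  shows "0 \<in> J" "f \<in> J \<Longrightarrow> g \<in> J \<Longrightarrow> f + g \<in> J" "f \<in> J \<Longrightarrow> h * f \<in> J" "f \<in> J \<Longrightarrow> f * h \<in> J"
    "f \<in> J \<Longrightarrow> - f \<in> J" "f \<in> J \<Longrightarrow> g \<in> J \<Longrightarrow> f - g \<in> J"
proof -
  show *: "0 \<in> J" "\<And>f g. f \<in> J \<Longrightarrow> g \<in> J \<Longrightarrow> f + g \<in> J" "\<And>f h. f \<in> J \<Longrightarrow> h * f \<in> J"
    "\<And>f h. f \<in> J \<Longrightarrow> f * h \<in> J"
    using assms by (auto simp: two_sided_ideal_def left_ideal_def)
  show **: "- f \<in> J" if "f \<in> J" for f
    using *(3)[OF that, of "- 1"] by simp
  show "f \<in> J \<Longrightarrow> g \<in> J \<Longrightarrow> f - g \<in> J"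
    using *(2)[of f "- g"] **[of g] by simp
qed


section \<open>Polynomials in commuting variables indexed by a finite type\<close>

text \<open>The same type serves for \<open>\<complex>[\<partial>]\<close>, \<open>\<complex>[\<theta>]\<close>, \<open>\<complex>[y]\<close> and \<open>\<complex>[\<partial>\<^sub>y]\<close>.\<close>

type_synonym 'n mpoly = "('n \<Rightarrow>\<^sub>0 nat) \<Rightarrow>\<^sub>0 complex"

definition mconst :: "complex \<Rightarrow> 'n mpoly"
  where "mconst c = single 0 c"

definition mvar :: "'n \<Rightarrow> 'n mpoly"
  where "mvar j = single (single j 1) 1"

definition mmonom :: "('n \<Rightarrow>\<^sub>0 nat) \<Rightarrow> 'n mpoly"
  where "mmonom a = single a 1"

definition meval :: "'n::finite mpoly \<Rightarrow> complex^'n \<Rightarrow> complex"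
  where "meval f z = (\<Sum>a\<in>keys f. lookup f a * (\<Prod>j\<in>UNIV. (z $ j) ^ lookup a j))"

definition mpderiv :: "'n \<Rightarrow> 'n mpoly \<Rightarrow> 'n mpoly"
  where "mpderiv j p =
    (\<Sum>a\<in>keys p. single (a - single j 1) (lookup p a * of_nat (lookup a j)))"

text \<open>The action \<open>q \<bullet> p\<close> of \<open>q \<in> \<complex>[\<partial>\<^sub>y]\<close> on \<open>p \<in> \<complex>[y]\<close>.  The fold composes the operators
  \<open>\<partial>\<^sub>y\<^sub>j\<close>, each taken \<open>lookup a j\<close> times; they commute (\<open>mpderiv_commute\<close> below).\<close>

definition diff_act :: "'n::finite mpoly \<Rightarrow> 'n mpoly \<Rightarrow> 'n mpoly"  (infixr \<open>\<bullet>\<^sub>y\<close> 75)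
  where "q \<bullet>\<^sub>y p =
    (\<Sum>a\<in>keys q. mconst (lookup q a) * Finite_Set.fold (\<lambda>j. mpderiv j ^^ lookup a j) p UNIV)"

lemma lookup_mconst_mult: "lookup (mconst c * p) b = c * lookup p b"
  unfolding mconst_def mult_map_scale_conv_mult[symmetric] by (simp add: Poly_Mapping.map.rep_eq when_def)

lemma lookup_mpderiv:
  "lookup (mpderiv j p) b = lookup p (b + single j 1) * of_nat (lookup b j + 1)"
proof -
  have "lookup (mpderiv j p) b =
      (\<Sum>a\<in>keys p. lookup p a * of_nat (lookup a j) when a - single j 1 = b)"
    by (simp add: mpderiv_def lookup_sum lookup_single)
  also have "\<dots> = (\<Sum>a\<in>keys p. if a = b + single j 1 then lookup p a * of_nat (lookup a j) else 0)"
  proof (rule sum.cong)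
    fix a
    show "(lookup p a * of_nat (lookup a j) when a - single j 1 = b) =
      (if a = b + single j 1 then lookup p a * of_nat (lookup a j) else 0)"
    proof (cases "lookup a j = 0")
      case False
      have "a - single j 1 = b \<longleftrightarrow> a = b + single j 1"
      proof
        assume b: "a - single j 1 = b"
        show "a = b + single j 1"
        proof (rule poly_mapping_eqI)
          fix k show "lookup a k = lookup (b + single j 1) k"
            using False by (auto simp: b[symmetric] lookup_add lookup_minus lookup_single when_def)
        qed
      qed auto
      then show ?thesis by (simp add: when_def)
    qed (auto simp: when_def)
  qed simp
  also have "\<dots> = lookup p (b + single j 1) * of_nat (lookup b j + 1)"
    by (simp add: in_keys_iff lookup_add)
  finally show ?thesis .
qed

lemma mpderiv_commute: "mpderiv i (mpderiv j p) = mpderiv j (mpderiv i p)"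
proof (rule poly_mapping_eqI)
  fix b
  show "lookup (mpderiv i (mpderiv j p)) b = lookup (mpderiv j (mpderiv i p)) b"
    by (cases "i = j") (simp_all add: lookup_mpderiv lookup_add lookup_single add_ac)
qed

lemma mpderiv_add: "mpderiv j (p + q) = mpderiv j p + mpderiv j q"
  by (rule poly_mapping_eqI) (simp add: lookup_mpderiv lookup_add algebra_simps)

lemma mpderiv_mconst_mult: "mpderiv j (mconst c * p) = mconst c * mpderiv j p"
  by (rule poly_mapping_eqI) (simp add: lookup_mpderiv lookup_mconst_mult)

lemma mpderiv_0: "mpderiv j 0 = 0"
  by (simp add: mpderiv_def)

lemma mconst_add: "mconst (c + d) = mconst c + mconst d"
  by (simp add: mconst_def single_add)

lemma mconst_diff: "mconst (c - d) = mconst c - mconst d"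
  by (simp add: mconst_def single_diff)

lemma mconst_mult: "mconst (c * d) = mconst c * mconst d"
  by (simp add: mconst_def mult_single)

lemma mconst_0: "mconst 0 = 0" and mconst_1: "mconst 1 = 1"
  by (simp_all add: mconst_def)


section \<open>The Weyl algebra\<close>

text \<open>The Weyl algebra is the free associative algebra on generators \<open>x\<^sub>j\<close>, \<open>\<partial>\<^sub>j\<close> modulo the
  two-sided ideal of the canonical commutation relations.  The free algebra is the monoid algebra
  of the free monoid, whose unit and product have to be written additively for the ring instances
  of \<^typ>\<open>'a \<Rightarrow>\<^sub>0 'b\<close> to apply.\<close>

datatype 'a free_monoid = Word (letters: "'a list")

instantiation free_monoid :: (type) monoid_add
begin

definition "0 = Word []"
definition "v + w = Word (letters v @ letters w)"

instance
  by standard (simp_all add: zero_free_monoid_def plus_free_monoid_def)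

end

datatype 'n weyl_gen = X 'n | D 'n

type_synonym 'n free_algebra = "'n weyl_gen free_monoid \<Rightarrow>\<^sub>0 complex"

definition gen :: "'n weyl_gen \<Rightarrow> 'n free_algebra"
  where "gen g = single (Word [g]) 1"

definition weyl_relations :: "'n free_algebra set"
  where "weyl_relations =
    {gen (X i) * gen (X j) - gen (X j) * gen (X i) | i j. True} \<union>
    {gen (D i) * gen (D j) - gen (D j) * gen (D i) | i j. True} \<union>
    {gen (D i) * gen (X j) - gen (X j) * gen (D i) - (if i = j then 1 else 0) | i j. True}"

definition weyl_eq :: "'n free_algebra \<Rightarrow> 'n free_algebra \<Rightarrow> bool"
  where "weyl_eq f g \<longleftrightarrow> f - g \<in> two_sided_ideal hull weyl_relations"

text \<open>A formal logarithmic series \<open>\<Sum>\<^sub>v x\<^sup>v r\<^sub>v(log x)\<close> is the family \<open>v \<mapsto> r\<^sub>v\<close> of its coefficients.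
  From \<open>\<partial>\<^sub>j (x\<^sup>v r(log x)) = x\<^bsup>v - e\<^sub>j\<^esup> ((v\<^sub>j + \<partial>\<^sub>y\<^sub>j) r)(log x)\<close> one reads off the
  coefficient of \<open>\<partial>\<^sub>j \<phi>\<close> at \<open>x\<^sup>v\<close>.\<close>

type_synonym 'n log_series = "complex^'n \<Rightarrow> 'n mpoly"

fun gen_act :: "'n::finite weyl_gen \<Rightarrow> 'n log_series \<Rightarrow> 'n log_series"
  where
    "gen_act (X j) \<phi> = (\<lambda>v. \<phi> (v - axis j 1))"
  | "gen_act (D j) \<phi> = (\<lambda>v. mconst (v $ j + 1) * \<phi> (v + axis j 1) + mpderiv j (\<phi> (v + axis j 1)))"

definition word_act :: "'n::finite weyl_gen free_monoid \<Rightarrow> 'n log_series \<Rightarrow> 'n log_series"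
  where "word_act w = foldr gen_act (letters w)"

definition free_act :: "'n::finite free_algebra \<Rightarrow> 'n log_series \<Rightarrow> 'n log_series"
  where "free_act f \<phi> = (\<lambda>v. \<Sum>w\<in>keys f. mconst (lookup f w) * word_act w \<phi> v)"

lemma gen_act_lin:
  "gen_act g (\<lambda>v. mconst c * \<phi> v + \<psi> v) v = mconst c * gen_act g \<phi> v + gen_act g \<psi> v"
  by (cases g) (simp_all add: mpderiv_add mpderiv_mconst_mult algebra_simps)

lemma gen_act_0: "gen_act g (\<lambda>v. 0) = (\<lambda>v. 0)"
  by (cases g) (simp_all add: mpderiv_0)

lemma word_act_lin:
  "word_act w (\<lambda>v. mconst c * \<phi> v + \<psi> v) = (\<lambda>v. mconst c * word_act w \<phi> v + word_act w \<psi> v)"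
proof -
  have "foldr gen_act gs (\<lambda>v. mconst c * \<phi> v + \<psi> v) =
    (\<lambda>v. mconst c * foldr gen_act gs \<phi> v + foldr gen_act gs \<psi> v)" for gs
  proof (induction gs)
    case (Cons g gs)
    show ?case by (rule ext) (simp add: Cons gen_act_lin)
  qed simp
  then show ?thesis by (simp add: word_act_def)
qed

lemma word_act_0: "word_act w (\<lambda>v. 0) = (\<lambda>v. 0)"
proof -
  have "foldr gen_act gs (\<lambda>v. 0) = (\<lambda>v. 0)" for gs :: "'a weyl_gen list"
    by (induction gs) (simp_all add: gen_act_0)
  then show ?thesis by (simp add: word_act_def)
qed

lemma word_act_sum:
  assumes "finite S"
  shows "word_act w (\<lambda>v. \<Sum>s\<in>S. mconst (c s) * \<psi> s v) =
    (\<lambda>v. \<Sum>s\<in>S. mconst (c s) * word_act w (\<psi> s) v)"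
  using assms by (induction S) (simp_all add: word_act_0 word_act_lin)

lemma word_act_plus: "word_act (u + w) \<phi> = word_act u (word_act w \<phi>)"
  by (simp add: word_act_def plus_free_monoid_def)

lemma free_act_add: "free_act (f + g) \<phi> v = free_act f \<phi> v + free_act g \<phi> v"
  unfolding free_act_def
  by (rule setsum_keys_plus_distrib) (simp_all add: mconst_0 mconst_add algebra_simps)

lemma free_act_0: "free_act 0 \<phi> v = 0"
  by (simp add: free_act_def)

lemma free_act_zero_series: "free_act f (\<lambda>v. 0) v = 0"
  by (simp add: free_act_def word_act_0)

lemma free_act_diff: "free_act (f - g) \<phi> v = free_act f \<phi> v - free_act g \<phi> v"
  using free_act_add[of "f - g" g \<phi> v] by simp

lemma free_act_single: "free_act (single w c) \<phi> v = mconst c * word_act w \<phi> v"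
  by (cases "c = 0") (simp_all add: free_act_def mconst_0)

lemma free_act_sum: "free_act (sum h S) \<phi> v = (\<Sum>s\<in>S. free_act (h s) \<phi> v)"
  by (induction S rule: infinite_finite_induct) (simp_all add: free_act_0 free_act_add)

lemma free_algebra_expand: "(f :: 'n free_algebra) = (\<Sum>w\<in>keys f. single w (lookup f w))"
  by (rule poly_mapping_eqI) (auto simp: lookup_sum lookup_single when_def in_keys_iff)

lemma free_act_mult:
  fixes f g :: "'n::finite free_algebra"
  shows "free_act (f * g) \<phi> = free_act f (free_act g \<phi>)"
proof
  fix v
  have "f * g = (\<Sum>u\<in>keys f. \<Sum>w\<in>keys g. single (u + w) (lookup f u * lookup g w))"
    by (subst free_algebra_expand[of f], subst free_algebra_expand[of g])
      (simp add: sum_product mult_single)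
  then have "free_act (f * g) \<phi> v = (\<Sum>u\<in>keys f. mconst (lookup f u) *
      (\<Sum>w\<in>keys g. mconst (lookup g w) * word_act u (word_act w \<phi>) v))"
    by (simp add: free_act_sum free_act_single word_act_plus mconst_mult sum_distrib_left mult.assoc)
  also have "\<dots> = free_act f (free_act g \<phi>) v"
    by (simp add: free_act_def word_act_sum)
  finally show "free_act (f * g) \<phi> v = free_act f (free_act g \<phi>) v" .
qed

lemma free_act_gen: "free_act (gen g) \<phi> = gen_act g \<phi>"
  by (rule ext) (simp add: gen_def free_act_single mconst_1 word_act_def)

lemma free_act_1: "free_act 1 \<phi> = \<phi>"
proof
  fix v show "free_act 1 \<phi> v = \<phi> v"
    using free_act_single[of 0 1 \<phi> v] by (simp add: mconst_1 word_act_def) (simp add: zero_free_monoid_def)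
qed

lemma weyl_relations_act:
  assumes "f \<in> weyl_relations"
  shows "free_act f \<phi> v = 0"
proof -
  have ac: "v + axis i 1 + axis j 1 = v + axis j 1 + axis i 1"
    "v - axis i 1 - axis j 1 = v - axis j 1 - axis i 1"
    "v + axis i 1 - axis j 1 = v - axis j 1 + axis i 1" for v :: "complex^'a" and i j
    by (simp_all add: algebra_simps)
  consider
      (XX) i j where "f = gen (X i) * gen (X j) - gen (X j) * gen (X i)"
    | (DD) i j where "f = gen (D i) * gen (D j) - gen (D j) * gen (D i)"
    | (DX) i j where "f = gen (D i) * gen (X j) - gen (X j) * gen (D i) - (if i = j then 1 else 0)"
    using assms unfolding weyl_relations_def by blast
  then show ?thesis
  proof cases
    case XX
    then show ?thesis by (simp add: free_act_diff free_act_mult free_act_gen ac(2)[of _ i j])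
  next
    case DD
    show ?thesis
      unfolding DD free_act_diff free_act_mult free_act_gen
      by (cases "i = j")
        (simp_all add: ac(1)[of _ i j] mpderiv_add mpderiv_mconst_mult mpderiv_commute[of i j] axis_def algebra_simps)
  next
    case DX
    show ?thesis
      unfolding DX free_act_diff free_act_mult free_act_gen
      by (cases "i = j")
        (simp_all add: ac(3) free_act_1 free_act_0 mconst_add mconst_diff mconst_1 axis_def algebra_simps)
  qed
qed

lemma weyl_ideal_act:
  assumes "f \<in> two_sided_ideal hull weyl_relations"
  shows "free_act f \<phi> v = 0"
proof -
  let ?K = "{f. \<forall>\<phi> v. free_act f \<phi> v = (0 :: 'a mpoly)}"
  have "two_sided_ideal ?K"
    unfolding two_sided_ideal_def left_ideal_def
  proof (intro conjI ballI allI)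
    fix h f assume "f \<in> ?K"
    then have *: "free_act f \<phi> = (\<lambda>v. 0)" for \<phi> by auto
    show "h * f \<in> ?K" "f * h \<in> ?K" by (simp_all add: free_act_mult * free_act_zero_series)
  qed (simp_all add: free_act_0 free_act_add)
  then have "two_sided_ideal hull weyl_relations \<subseteq> ?K"
    by (intro hull_minimal) (auto simp: weyl_relations_act)
  then show ?thesis using assms by blast
qed

lemma weyl_eq_equivp: "equivp (weyl_eq :: 'n free_algebra \<Rightarrow> _)"
proof (rule equivpI)
  note I = two_sided_idealD[OF two_sided_ideal_hull[of "weyl_relations :: 'n free_algebra set"]]
  show "reflp (weyl_eq :: 'n free_algebra \<Rightarrow> _)" by (auto simp: reflp_def weyl_eq_def I(1))
  show "symp (weyl_eq :: 'n free_algebra \<Rightarrow> _)"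
  proof (rule sympI)
    fix f g :: "'n free_algebra"
    assume "weyl_eq f g"
    then have "- (f - g) \<in> two_sided_ideal hull weyl_relations" unfolding weyl_eq_def by (rule I(5))
    then show "weyl_eq g f" by (simp add: weyl_eq_def)
  qed
  show "transp (weyl_eq :: 'n free_algebra \<Rightarrow> _)"
  proof (rule transpI)
    fix f g h :: "'n free_algebra"
    assume "weyl_eq f g" "weyl_eq g h"
    moreover have "f - h = (f - g) + (g - h)" by simp
    ultimately show "weyl_eq f h" unfolding weyl_eq_def by (metis I(2))
  qed
qed

quotient_type 'n weyl = "'n::finite free_algebra" / weyl_eq
  by (rule weyl_eq_equivp)

instantiation weyl :: (finite) ring_1
begin

lift_definition zero_weyl :: "'a weyl" is 0 .
lift_definition one_weyl :: "'a weyl" is 1 .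

lift_definition plus_weyl :: "'a weyl \<Rightarrow> 'a weyl \<Rightarrow> 'a weyl" is "(+)"
proof -
  fix f f' g g' :: "'a free_algebra"
  assume "weyl_eq f f'" "weyl_eq g g'"
  moreover have "f + g - (f' + g') = (f - f') + (g - g')" by simp
  ultimately show "weyl_eq (f + g) (f' + g')"
    unfolding weyl_eq_def by (simp only: two_sided_idealD(2)[OF two_sided_ideal_hull])
qed

lift_definition uminus_weyl :: "'a weyl \<Rightarrow> 'a weyl" is uminus
proof -
  fix f f' :: "'a free_algebra"
  assume "weyl_eq f f'"
  moreover have "- f - - f' = - (f - f')" by simp
  ultimately show "weyl_eq (- f) (- f')"
    unfolding weyl_eq_def by (simp only: two_sided_idealD(5)[OF two_sided_ideal_hull])
qed

lift_definition minus_weyl :: "'a weyl \<Rightarrow> 'a weyl \<Rightarrow> 'a weyl" is "(-)"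
proof -
  fix f f' g g' :: "'a free_algebra"
  assume "weyl_eq f f'" "weyl_eq g g'"
  moreover have "f - g - (f' - g') = (f - f') - (g - g')" by simp
  ultimately show "weyl_eq (f - g) (f' - g')"
    unfolding weyl_eq_def by (simp only: two_sided_idealD(6)[OF two_sided_ideal_hull])
qed

lift_definition times_weyl :: "'a weyl \<Rightarrow> 'a weyl \<Rightarrow> 'a weyl" is "(*)"
proof -
  fix f f' g g' :: "'a free_algebra"
  assume "weyl_eq f f'" "weyl_eq g g'"
  moreover have "f * g - f' * g' = (f - f') * g + f' * (g - g')" by (simp add: algebra_simps)
  ultimately show "weyl_eq (f * g) (f' * g')"
    unfolding weyl_eq_def by (simp only: two_sided_idealD(2-4)[OF two_sided_ideal_hull])
qed

instance
proof
  show "(0 :: 'a weyl) \<noteq> 1"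
  proof transfer
    show "\<not> weyl_eq 0 (1 :: 'a free_algebra)"
    proof
      assume "weyl_eq 0 (1 :: 'a free_algebra)"
      then have "free_act (0 - 1 :: 'a free_algebra) (\<lambda>v. 1) 0 = 0"
        unfolding weyl_eq_def by (rule weyl_ideal_act)
      then show False by (simp only: free_act_diff free_act_0 free_act_1) simp
    qed
  qed
qed (transfer; simp add: algebra_simps equivp_reflp[OF weyl_eq_equivp])+

end

lift_definition weyl_act :: "'n::finite weyl \<Rightarrow> 'n log_series \<Rightarrow> 'n log_series" is free_act
proof (intro ext)
  fix f g :: "'n free_algebra" and \<phi> v
  assume "weyl_eq f g"
  then have "free_act (f - g) \<phi> v = 0" unfolding weyl_eq_def by (rule weyl_ideal_act)
  then show "free_act f \<phi> v = free_act g \<phi> v" by (simp add: free_act_diff)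
qed

lift_definition weyl_const :: "complex \<Rightarrow> 'n::finite weyl" is "\<lambda>c. single 0 c" .
lift_definition weyl_x :: "'n::finite \<Rightarrow> 'n weyl" is "\<lambda>j. gen (X j)" .
lift_definition weyl_d :: "'n::finite \<Rightarrow> 'n weyl" is "\<lambda>j. gen (D j)" .

definition weyl_theta :: "'n::finite \<Rightarrow> 'n weyl"
  where "weyl_theta j = weyl_x j * weyl_d j"

lemma weyl_eq_relation: "f - g \<in> weyl_relations \<Longrightarrow> weyl_eq f g"
  unfolding weyl_eq_def by (rule hull_inc)

lemma weyl_x_commute: "weyl_x i * weyl_x j = weyl_x j * (weyl_x i :: 'n::finite weyl)"
  by (transfer, rule weyl_eq_relation) (unfold weyl_relations_def, blast)

lemma weyl_d_commute: "weyl_d i * weyl_d j = weyl_d j * (weyl_d i :: 'n::finite weyl)"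
  by (transfer, rule weyl_eq_relation) (unfold weyl_relations_def, blast)

lemma weyl_d_x_same: "weyl_d i * weyl_x i - weyl_x i * weyl_d i = (1 :: 'n::finite weyl)"
proof (transfer, rule weyl_eq_relation)
  fix i :: 'n
  have "gen (D i) * gen (X i) - gen (X i) * gen (D i) - (if i = i then 1 else 0)
    \<in> (weyl_relations :: 'n free_algebra set)"
    unfolding weyl_relations_def by blast
  then show "gen (D i) * gen (X i) - gen (X i) * gen (D i) - 1
    \<in> (weyl_relations :: 'n free_algebra set)" by simp
qed

lemma weyl_d_x_other:
  assumes "i \<noteq> j"
  shows "weyl_d i * weyl_x j = weyl_x j * (weyl_d i :: 'n::finite weyl)"
  using assms
proof (transfer, intro weyl_eq_relation)
  fix i j :: 'n
  assume "i \<noteq> j"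
  have "gen (D i) * gen (X j) - gen (X j) * gen (D i) - (if i = j then 1 else 0)
    \<in> (weyl_relations :: 'n free_algebra set)"
    unfolding weyl_relations_def by blast
  then show "gen (D i) * gen (X j) - gen (X j) * gen (D i)
    \<in> (weyl_relations :: 'n free_algebra set)" using \<open>i \<noteq> j\<close> by simp
qed

lemma weyl_theta_commute:
  "weyl_theta i * weyl_theta j = weyl_theta j * (weyl_theta i :: 'n::finite weyl)"
proof (cases "i = j")
  case False
  have "weyl_x i * weyl_d i * (weyl_x j * weyl_d j) = weyl_x i * weyl_x j * (weyl_d i * weyl_d j)"
    using weyl_d_x_other[OF False] by (metis mult.assoc)
  also have "\<dots> = weyl_x j * weyl_x i * (weyl_d j * weyl_d i)"
    by (simp only: weyl_x_commute[of i j] weyl_d_commute[of i j])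
  also have "\<dots> = weyl_x j * weyl_d j * (weyl_x i * weyl_d i)"
    using weyl_d_x_other[OF False[symmetric]] by (metis mult.assoc)
  finally show ?thesis by (simp only: weyl_theta_def)
qed simp

lemma weyl_act_mult: "weyl_act (P * Q) \<phi> = weyl_act P (weyl_act Q \<phi>)"
  by transfer (rule free_act_mult)

lemma weyl_act_add: "weyl_act (P + Q) \<phi> v = weyl_act P \<phi> v + weyl_act Q \<phi> v"
  by transfer (rule free_act_add)

lemma weyl_act_x: "weyl_act (weyl_x j) \<phi> = gen_act (X j) \<phi>"
  by transfer (rule free_act_gen)

lemma weyl_act_d: "weyl_act (weyl_d j) \<phi> = gen_act (D j) \<phi>"
  by transfer (rule free_act_gen)

text \<open>Substitution of the operators \<open>t j\<close> for the variables of a commutative polynomial.  It is used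
  only for \<open>t = weyl_d\<close> and \<open>t = weyl_theta\<close>, whose values commute, so that the order in
  which the fold multiplies the powers \<open>t j ^ lookup a j\<close> does not matter.\<close>

definition weyl_subst :: "('n::finite \<Rightarrow> 'n weyl) \<Rightarrow> 'n mpoly \<Rightarrow> 'n weyl"
  where "weyl_subst t f = (\<Sum>a\<in>keys f.
    weyl_const (lookup f a) * Finite_Set.fold (\<lambda>j. (*) (t j ^ lookup a j)) 1 UNIV)"


section \<open>Hypergeometric systems\<close>

definition rat_matrix :: "int^'n^'d \<Rightarrow> rat^'n^'d"
  where "rat_matrix A = (\<chi> i j. of_int (A $ i $ j))"

definition columns_on_hyperplane :: "int^'n::finite^'d::finite \<Rightarrow> bool"
  where "columns_on_hyperplane A \<longleftrightarrow> (\<exists>h :: rat^'d. \<exists>c. h \<noteq> 0 \<and> c \<noteq> 0 \<and>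
    (\<forall>a\<in>columns (rat_matrix A). (\<Sum>i\<in>UNIV. h $ i * a $ i) = c))"

definition ker_lattice :: "int^'n::finite^'d::finite \<Rightarrow> (int^'n) set"
  where "ker_lattice A = {u. A *v u = 0}"

definition toric_ideal :: "int^'n::finite^'d::finite \<Rightarrow> 'n mpoly set"
  where "toric_ideal A = left_ideal hull {mmonom a - mmonom b | a b.
    A *v (\<chi> j. int (lookup a j)) = A *v (\<chi> j. int (lookup b j))}"

definition hypergeometric_ideal :: "int^'n::finite^'d::finite \<Rightarrow> complex^'d \<Rightarrow> 'n weyl set"
  where "hypergeometric_ideal A \<beta> = left_ideal hull
    (weyl_subst weyl_d ` toric_ideal A \<union>
     range (\<lambda>i. (\<Sum>j\<in>UNIV. of_int (A $ i $ j) * weyl_theta j) - weyl_const (\<beta> $ i)))"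

definition annihilated_by :: "'n::finite log_series \<Rightarrow> 'n weyl set \<Rightarrow> bool"
  where "annihilated_by \<phi> J \<longleftrightarrow> (\<forall>P\<in>J. weyl_act P \<phi> = (\<lambda>v. 0))"

definition weight :: "real^'n::finite \<Rightarrow> ('n \<Rightarrow>\<^sub>0 nat) \<Rightarrow> real"
  where "weight w a = (\<Sum>j\<in>UNIV. w $ j * of_nat (lookup a j))"

definition initial_form :: "real^'n::finite \<Rightarrow> 'n mpoly \<Rightarrow> 'n mpoly"
  where "initial_form w f = (\<Sum>a | a \<in> keys f \<and> (\<forall>b\<in>keys f. weight w b \<le> weight w a).
    single a (lookup f a))"

definition initial_ideal :: "real^'n::finite \<Rightarrow> 'n mpoly set \<Rightarrow> 'n mpoly set"
  where "initial_ideal w J = left_ideal hull (initial_form w ` J)"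

definition monomial_ideal :: "'n mpoly set \<Rightarrow> bool"
  where "monomial_ideal J \<longleftrightarrow> (\<exists>S. J = left_ideal hull (mmonom ` S))"

definition generic_weight :: "int^'n::finite^'d::finite \<Rightarrow> real^'n \<Rightarrow> bool"
  where "generic_weight A w \<longleftrightarrow> monomial_ideal (initial_ideal w (toric_ideal A))"

definition fake_indicial_ideal ::
    "int^'n::finite^'d::finite \<Rightarrow> complex^'d \<Rightarrow> real^'n \<Rightarrow> 'n mpoly set"
  where "fake_indicial_ideal A \<beta> w = {f + g | f g.
    weyl_subst weyl_theta f \<in>
      left_ideal hull (weyl_subst weyl_d ` initial_ideal w (toric_ideal A)) \<and>
    g \<in> left_ideal hull
      range (\<lambda>i. (\<Sum>j\<in>UNIV. of_int (A $ i $ j) * mvar j) - mconst (\<beta> $ i))}"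

definition fake_exponent ::
    "int^'n::finite^'d::finite \<Rightarrow> complex^'d \<Rightarrow> real^'n \<Rightarrow> complex^'n \<Rightarrow> bool"
  where "fake_exponent A \<beta> w v\<^sub>0 \<longleftrightarrow> (\<forall>f\<in>fake_indicial_ideal A \<beta> w. meval f v\<^sub>0 = 0)"


section \<open>Negative supports\<close>

definition shift :: "complex^'n \<Rightarrow> int^'n \<Rightarrow> complex^'n"
  where "shift v\<^sub>0 u = (\<chi> j. v\<^sub>0 $ j + of_int (u $ j))"

definition neg_supp :: "complex^'n \<Rightarrow> int^'n \<Rightarrow> 'n set"
  where "neg_supp v\<^sub>0 u = {j. \<exists>k::int. k < 0 \<and> shift v\<^sub>0 u $ j = of_int k}"

definition neg_supps :: "int^'n::finite^'d::finite \<Rightarrow> complex^'n \<Rightarrow> 'n set set"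
  where "neg_supps A v\<^sub>0 = neg_supp v\<^sub>0 ` ker_lattice A"

definition nonneg_weight_supps ::
    "int^'n::finite^'d::finite \<Rightarrow> real^'n \<Rightarrow> complex^'n \<Rightarrow> 'n set set"
  where "nonneg_weight_supps A w v\<^sub>0 = {I \<in> neg_supps A v\<^sub>0.
    \<forall>u\<in>ker_lattice A. neg_supp v\<^sub>0 u = I \<longrightarrow> (\<Sum>j\<in>UNIV. w $ j * of_int (u $ j)) \<ge> 0}"

definition negative_support_family ::
    "int^'n::finite^'d::finite \<Rightarrow> real^'n \<Rightarrow> complex^'n \<Rightarrow> 'n set set \<Rightarrow> bool"
  where "negative_support_family A w v\<^sub>0 N \<longleftrightarrow>
    neg_supp v\<^sub>0 0 \<in> N \<and> N \<subseteq> nonneg_weight_supps A w v\<^sub>0"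

definition ordered_family :: "int^'n::finite^'d::finite \<Rightarrow> complex^'n \<Rightarrow> 'n set set \<Rightarrow> bool"
  where "ordered_family A v\<^sub>0 N \<longleftrightarrow> (\<forall>I\<in>N. \<forall>J\<in>neg_supps A v\<^sub>0. J \<subseteq> I \<longrightarrow> J \<in> N)"

text \<open>The series \<open>\<Sum> x\<^bsup>v\<^sub>0 + u\<^esup> r\<^sub>u(log x)\<close> over all \<open>u \<in> L\<close> with negative support in \<open>N\<close>.
  At most one \<open>u\<close> contributes to each coefficient.\<close>

definition phi_series ::
    "int^'n::finite^'d::finite \<Rightarrow> complex^'n \<Rightarrow> 'n set set \<Rightarrow> (int^'n \<Rightarrow> 'n mpoly) \<Rightarrow> 'n log_series"
  where "phi_series A v\<^sub>0 N r =
    (\<lambda>v. \<Sum>u | u \<in> ker_lattice A \<and> neg_supp v\<^sub>0 u \<in> N \<and> shift v\<^sub>0 u = v. r u)"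


section \<open>Normalized coefficients\<close>

definition mvar_prod :: "'n::finite set \<Rightarrow> 'n mpoly"
  where "mvar_prod S = (\<Prod>j\<in>S. mvar j)"

text \<open>\<open>d_op v\<^sub>0 u' u\<close> and \<open>dtilde v\<^sub>0 u' u\<close> are the operators from \<open>u\<close> to \<open>u'\<close>.\<close>

definition d_op :: "complex^'n::finite \<Rightarrow> int^'n \<Rightarrow> int^'n \<Rightarrow> 'n mpoly"
  where "d_op v\<^sub>0 u' u = (\<Prod>\<nu>\<in>UNIV. \<Prod>\<mu>\<in>{1..u $ \<nu> - u' $ \<nu>}.
    (mvar \<nu> + mconst (v\<^sub>0 $ \<nu> + of_int (u $ \<nu>) - of_int \<mu> + 1)))"

definition dtilde :: "complex^'n::finite \<Rightarrow> int^'n \<Rightarrow> int^'n \<Rightarrow> 'n mpoly"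
  where "dtilde v\<^sub>0 u' u = (THE q. lookup q 0 \<noteq> 0 \<and>
    d_op v\<^sub>0 u' u = q * mvar_prod (neg_supp v\<^sub>0 u' - neg_supp v\<^sub>0 u))"

definition normalized_coeff ::
    "complex^'n::finite \<Rightarrow> (int^'n \<Rightarrow> 'n mpoly) \<Rightarrow> int^'n \<Rightarrow> 'n mpoly"
  where "normalized_coeff v\<^sub>0 r u = inv (\<lambda>p. dtilde v\<^sub>0 u 0 \<bullet>\<^sub>y p) (dtilde v\<^sub>0 0 u \<bullet>\<^sub>y r u)"

text \<open>The value \<open>c\<^sub>I\<close> of a family \<open>c\<close> on \<open>L\<close>; it does not depend on the chosen \<open>u\<close> when \<open>c\<^sub>u\<close> depends
  only on the negative support of \<open>u\<close>.\<close>

definition coeff_at ::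
    "int^'n::finite^'d::finite \<Rightarrow> complex^'n \<Rightarrow> (int^'n \<Rightarrow> 'n mpoly) \<Rightarrow> 'n set \<Rightarrow> 'n mpoly"
  where "coeff_at A v\<^sub>0 c I = c (SOME u. u \<in> ker_lattice A \<and> neg_supp v\<^sub>0 u = I)"

end

theory Submission
  imports Defs
begin

text \<open>Comparing coefficients of \<open>x\<^bsup>v\<^sub>0 + u\<^esup>\<close>, the Euler operators say that \<open>\<Sum>\<^sub>j a\<^sub>i\<^sub>j \<partial>\<^sub>y\<^sub>j\<close> kills every
  \<open>r\<^sub>u\<close> (because \<open>A v\<^sub>0 = \<beta>\<close> for a fake exponent), and the toric binomials say that
  \<open>d\<^bsub>u'\<leftarrow>u\<^esub> \<bullet> r\<^sub>u = d\<^bsub>u\<leftarrow>u'\<^esub> \<bullet> r\<^sub>u\<^sub>'\<close> for all \<open>u, u' \<in> L\<close>.  Operators with nonzero constant term act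
  bijectively, and the regular parts of the \<open>d\<^bsub>u'\<leftarrow>u\<^esub>\<close> satisfy a cocycle identity in \<open>u, u', 0\<close>; hence in
  terms of the normalized coefficients both conditions lose their regular parts and become
  \<open>\<Sum>\<^sub>j a\<^sub>i\<^sub>j \<partial>\<^sub>y\<^sub>j \<bullet> c\<^sub>u = 0\<close> and \<open>\<partial>\<^sub>y\<^bsup>I' - I\<^esup> \<bullet> c\<^sub>u = \<partial>\<^sub>y\<^bsup>I - I'\<^esup> \<bullet> c\<^sub>u\<^sub>'\<close>, where \<open>I, I'\<close> are the
  negative supports of \<open>u, u'\<close>.  The case \<open>I = I'\<close> of the latter is condition (1).\<close>

section \<open>Constant-coefficient differential operators acting on polynomials\<close>

lemma mpoly_induct [case_names zero monom add]:
  assumes "P 0" "\<And>a c. P (single a c)" "\<And>f g. P f \<Longrightarrow> P g \<Longrightarrow> P (f + g)"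
  shows "P (f :: 'a \<Rightarrow>\<^sub>0 'b::comm_monoid_add)"
proof -
  have "f = (\<Sum>a\<in>keys f. single a (lookup f a))"
    by (rule poly_mapping_eqI) (auto simp: lookup_sum lookup_single when_def in_keys_iff)
  moreover have "P (\<Sum>a\<in>S. single a (lookup f a))" for S
    by (induction S rule: infinite_finite_induct) (auto intro: assms)
  ultimately show ?thesis by metis
qed

text \<open>The coefficients with respect to the divided powers \<open>y\<^sup>b / b!\<close>, on which \<open>\<partial>\<^sub>y\<^sup>a\<close> acts as a
  plain index shift.\<close>

definition dcoeff :: "'n::finite mpoly \<Rightarrow> ('n \<Rightarrow>\<^sub>0 nat) \<Rightarrow> complex"
  where "dcoeff p b = lookup p b * (\<Prod>j\<in>UNIV. fact (lookup b j))"

lemma dcoeff_eqI: "(\<And>b. dcoeff p b = dcoeff q b) \<Longrightarrow> p = q"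
  by (rule poly_mapping_eqI) (simp add: dcoeff_def)

lemma dcoeff_0: "dcoeff 0 b = 0"
  and dcoeff_add: "dcoeff (p + q) b = dcoeff p b + dcoeff q b"
  and dcoeff_diff: "dcoeff (p - q) b = dcoeff p b - dcoeff q b"
  and dcoeff_mconst_mult: "dcoeff (mconst c * p) b = c * dcoeff p b"
  by (simp_all add: dcoeff_def lookup_add lookup_minus lookup_mconst_mult distrib_right left_diff_distrib)

lemma dcoeff_sum: "dcoeff (sum h S) b = (\<Sum>s\<in>S. dcoeff (h s) b)"
  by (induction S rule: infinite_finite_induct) (simp_all add: dcoeff_0 dcoeff_add)

lemma dcoeff_eq_0_iff: "dcoeff p b = 0 \<longleftrightarrow> b \<notin> keys p"
  by (simp add: dcoeff_def in_keys_iff)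

lemma dcoeff_mpderiv: "dcoeff (mpderiv j p) b = dcoeff p (b + single j 1)"
proof -
  have "(\<Prod>i\<in>UNIV. fact (lookup (b + single j 1) i)) =
      (fact (lookup b j + 1) :: complex) * (\<Prod>i\<in>UNIV - {j}. fact (lookup b i))"
    by (subst prod.remove[of _ j]) (auto simp: lookup_add lookup_single when_def intro!: prod.cong)
  moreover have "(\<Prod>i\<in>UNIV. fact (lookup b i)) =
      (fact (lookup b j) :: complex) * (\<Prod>i\<in>UNIV - {j}. fact (lookup b i))"
    by (subst prod.remove[of _ j]) auto
  ultimately show ?thesis by (simp add: dcoeff_def lookup_mpderiv)
qed

lemma dcoeff_mpderiv_funpow: "dcoeff ((mpderiv j ^^ k) p) b = dcoeff p (b + single j k)"
proof (induction k arbitrary: b)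
  case (Suc k)
  have "b + single j 1 + single j k = b + single j (Suc k)"
    by (simp add: add.assoc flip: single_add)
  then show ?case by (simp add: dcoeff_mpderiv Suc)
qed simp

text \<open>Index shifts commute, so the fold can be unfolded one variable at a time; the
  one-variable shifts add up to \<open>a\<close>.\<close>

lemma dcoeff_mpderiv_fold:
  "dcoeff (Finite_Set.fold (\<lambda>j. mpderiv j ^^ lookup a j) p UNIV) b = dcoeff p (a + b)"
proof -
  interpret comp_fun_commute "\<lambda>j. mpderiv j ^^ lookup a j"
  proof
    fix i j
    show "(mpderiv i ^^ lookup a i) \<circ> (mpderiv j ^^ lookup a j) =
        (mpderiv j ^^ lookup a j) \<circ> (mpderiv i ^^ lookup a i)"
      by (rule ext, rule dcoeff_eqI) (simp add: dcoeff_mpderiv_funpow add_ac)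
  qed
  have "dcoeff (Finite_Set.fold (\<lambda>j. mpderiv j ^^ lookup a j) p F) b =
      dcoeff p ((\<Sum>j\<in>F. single j (lookup a j)) + b)" if "finite F" for F
    using that by (induction F arbitrary: b) (simp_all add: dcoeff_mpderiv_funpow add_ac)
  moreover have "(\<Sum>j\<in>UNIV. single j (lookup a j)) = a"
    by (rule poly_mapping_eqI) (simp add: lookup_sum lookup_single when_def)
  ultimately show ?thesis by simp
qed

text \<open>This contraction formula is the working description of the action: linearity in either
  argument and the top-degree argument are read off from it.\<close>

lemma dcoeff_diff_act: "dcoeff (q \<bullet>\<^sub>y p) b = (\<Sum>a\<in>keys q. lookup q a * dcoeff p (a + b))"
  by (simp add: diff_act_def dcoeff_sum dcoeff_mconst_mult dcoeff_mpderiv_fold)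

lemma dcoeff_diff_act_single: "dcoeff (single a c \<bullet>\<^sub>y p) b = c * dcoeff p (a + b)"
  by (simp add: dcoeff_diff_act)

lemma diff_act_add_left: "(q + q') \<bullet>\<^sub>y p = q \<bullet>\<^sub>y p + q' \<bullet>\<^sub>y p"
proof (rule dcoeff_eqI)
  fix b
  show "dcoeff ((q + q') \<bullet>\<^sub>y p) b = dcoeff (q \<bullet>\<^sub>y p + q' \<bullet>\<^sub>y p) b"
    unfolding dcoeff_diff_act dcoeff_add
    by (rule setsum_keys_plus_distrib) (simp_all add: algebra_simps)
qed

lemma diff_act_0_left [simp]: "0 \<bullet>\<^sub>y p = 0"
  by (simp add: diff_act_def)

lemma diff_act_sum_left: "sum h S \<bullet>\<^sub>y p = (\<Sum>s\<in>S. h s \<bullet>\<^sub>y p)"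
  by (induction S rule: infinite_finite_induct) (simp_all add: diff_act_add_left)

lemma diff_act_add_right: "q \<bullet>\<^sub>y (p + p') = q \<bullet>\<^sub>y p + q \<bullet>\<^sub>y p'"
  by (rule dcoeff_eqI) (simp add: dcoeff_diff_act dcoeff_add algebra_simps sum.distrib)

lemma diff_act_diff_right: "q \<bullet>\<^sub>y (p - p') = q \<bullet>\<^sub>y p - q \<bullet>\<^sub>y p'"
  by (rule dcoeff_eqI) (simp add: dcoeff_diff_act dcoeff_diff algebra_simps sum_subtractf)

lemma diff_act_0_right [simp]: "q \<bullet>\<^sub>y 0 = 0"
  by (rule dcoeff_eqI) (simp add: dcoeff_diff_act dcoeff_0)

lemma diff_act_mconst_mult_right: "q \<bullet>\<^sub>y (mconst c * p) = mconst c * (q \<bullet>\<^sub>y p)"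
  by (rule dcoeff_eqI) (simp add: dcoeff_diff_act dcoeff_mconst_mult sum_distrib_left mult.left_commute)

lemma diff_act_mconst: "mconst c \<bullet>\<^sub>y p = mconst c * p"
  by (rule dcoeff_eqI) (simp add: mconst_def dcoeff_diff_act_single dcoeff_mconst_mult[unfolded mconst_def])

lemma diff_act_1 [simp]: "1 \<bullet>\<^sub>y p = p"
  using diff_act_mconst[of 1 p] by (simp add: mconst_1)

lemma diff_act_mvar: "mvar j \<bullet>\<^sub>y p = mpderiv j p"
  by (rule dcoeff_eqI) (simp add: mvar_def dcoeff_diff_act_single dcoeff_mpderiv add.commute)

text \<open>On monomials both sides shift the index by the sum of the exponents. Polynomials thus
  form a module over a commutative ring of operators, whose factors may be permuted.\<close>

lemma diff_act_mult: "(q * q') \<bullet>\<^sub>y p = q \<bullet>\<^sub>y q' \<bullet>\<^sub>y p"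
proof (induction q rule: mpoly_induct)
  case (monom a c)
  show ?case
  proof (induction q' rule: mpoly_induct)
    case (monom a' c')
    show ?case
      by (rule dcoeff_eqI) (simp add: mult_single dcoeff_diff_act_single add_ac)
  qed (simp_all add: diff_act_add_left diff_act_add_right distrib_left)
qed (simp_all add: diff_act_add_left distrib_right)

lemma diff_act_commute: "q \<bullet>\<^sub>y q' \<bullet>\<^sub>y p = q' \<bullet>\<^sub>y q \<bullet>\<^sub>y p"
  by (metis diff_act_mult mult.commute)

section \<open>Constant terms, degrees and bijectivity of the action\<close>

lemma lookup_mult_0:
  fixes q q' :: "('a \<Rightarrow>\<^sub>0 nat) \<Rightarrow>\<^sub>0 'b::comm_semiring_1"
  shows "lookup (q * q') 0 = lookup q 0 * lookup q' 0"
proof (induction q rule: mpoly_induct)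
  case (monom a c)
  show ?case
  proof (induction q' rule: mpoly_induct)
    case (monom a' c')
    \<comment> \<open>Exponents are natural numbers, so nothing can cancel in a sum of two of
      them.\<close>
    have "a + a' = 0 \<longleftrightarrow> a = 0 \<and> a' = 0"
      by (auto simp: poly_mapping_eq_iff fun_eq_iff lookup_add)
    then show ?case by (auto simp: mult_single lookup_single when_def)
  qed (simp_all add: lookup_add distrib_left)
qed (simp_all add: lookup_add distrib_right)

lemma lookup_prod_0:
  "lookup (prod h S) 0 = (\<Prod>s\<in>S. lookup (h s :: ('a \<Rightarrow>\<^sub>0 nat) \<Rightarrow>\<^sub>0 'b::comm_semiring_1) 0)"
  by (induction S rule: infinite_finite_induct) (simp_all add: lookup_mult_0 lookup_one)

definition total_deg :: "('n::finite \<Rightarrow>\<^sub>0 nat) \<Rightarrow> nat"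
  where "total_deg b = (\<Sum>j\<in>UNIV. lookup b j)"

lemma total_deg_add_less: "a \<noteq> 0 \<Longrightarrow> total_deg b < total_deg (a + b)"
  by (auto simp: total_deg_def lookup_add sum.distrib poly_mapping_eq_iff fun_eq_iff intro!: Nat.gr0I)

text \<open>Every nonconstant monomial of \<open>q\<close> reads \<open>p\<close> at an index of
  larger degree than \<open>b\<close>, where \<open>p\<close> has no term.\<close>

lemma dcoeff_diff_act_top:
  assumes "\<And>a. total_deg b < total_deg a \<Longrightarrow> a \<notin> keys p"
  shows "dcoeff (q \<bullet>\<^sub>y p) b = lookup q 0 * dcoeff p b"
proof -
  have "dcoeff p (a + b) = 0" if "a \<noteq> 0" for a
    using assms total_deg_add_less[OF that] by (simp add: dcoeff_eq_0_iff)
  then have "dcoeff (q \<bullet>\<^sub>y p) b = (\<Sum>a\<in>keys q. if a = 0 then lookup q 0 * dcoeff p b else 0)"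
    unfolding dcoeff_diff_act by (intro sum.cong) auto
  then show ?thesis by (simp add: in_keys_iff)
qed

text \<open>A nonzero \<open>p\<close> has a term of top degree, and \<open>q\<close> merely
  rescales it by its nonzero constant term.\<close>

lemma diff_act_eq_0_iff:
  assumes "lookup q 0 \<noteq> 0"
  shows "q \<bullet>\<^sub>y p = 0 \<longleftrightarrow> p = 0"
proof
  assume "q \<bullet>\<^sub>y p = 0"
  show "p = 0"
  proof (rule ccontr)
    assume "p \<noteq> 0"
    then have "keys p \<noteq> {}" by (auto simp: poly_mapping_eq_iff fun_eq_iff in_keys_iff)
    then have "Max (total_deg ` keys p) \<in> total_deg ` keys p" by (intro Max_in) auto
    then obtain b where b: "b \<in> keys p" "total_deg b = Max (total_deg ` keys p)" by (metis imageE)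
    then have "dcoeff (q \<bullet>\<^sub>y p) b = lookup q 0 * dcoeff p b"
      by (intro dcoeff_diff_act_top) (metis Max_ge finite_imageI finite_keys imageI leD)
    then show False
      using \<open>q \<bullet>\<^sub>y p = 0\<close> assms b(1) by (auto simp: dcoeff_0 dcoeff_eq_0_iff)
  qed
qed simp

lemma diff_act_cancel:
  assumes "lookup q 0 \<noteq> 0"
  shows "q \<bullet>\<^sub>y p = q \<bullet>\<^sub>y p' \<longleftrightarrow> p = p'"
  using diff_act_eq_0_iff[OF assms, of "p - p'"] by (simp add: diff_act_diff_right)

text \<open>Dividing by the constant term of \<open>q\<close> solves \<open>q \<bullet> p' = p\<close> up to terms of smaller degree.\<close>

lemma diff_act_surj:
  assumes "lookup q 0 \<noteq> 0"
  shows "surj (\<lambda>p. q \<bullet>\<^sub>y p)"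
proof -
  have solve: "\<exists>p'. q \<bullet>\<^sub>y p' = p" if "\<forall>b\<in>keys p. total_deg b < m" for m p
    using that
  proof (induction m arbitrary: p)
    case 0
    then have "p = 0" by (auto simp: poly_mapping_eq_iff fun_eq_iff in_keys_iff)
    then show ?case by (auto intro: exI[of _ 0])
  next
    case (Suc m)
    define p1 where "p1 = mconst (inverse (lookup q 0)) * p"
    have "total_deg b < m" if "b \<in> keys (p - q \<bullet>\<^sub>y p1)" for b
    proof (rule ccontr)
      assume "\<not> total_deg b < m"
      then have "a \<notin> keys p" if "total_deg b < total_deg a" for a
        using Suc.prems that by fastforce
      then have "dcoeff (q \<bullet>\<^sub>y p1) b = lookup q 0 * dcoeff p1 b"
        by (intro dcoeff_diff_act_top) (simp add: p1_def dcoeff_mconst_mult flip: dcoeff_eq_0_iff)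
      then have "dcoeff (p - q \<bullet>\<^sub>y p1) b = 0"
        using assms by (simp add: p1_def dcoeff_mconst_mult dcoeff_diff)
      then show False using that by (simp add: dcoeff_eq_0_iff)
    qed
    with Suc.IH obtain p2 where "q \<bullet>\<^sub>y p2 = p - q \<bullet>\<^sub>y p1" by blast
    then have "q \<bullet>\<^sub>y (p1 + p2) = p" by (simp add: diff_act_add_right)
    then show ?case ..
  qed
  \<comment> \<open>The degree bound in \<open>solve\<close> is strict, hence the
    \<open>Suc\<close>. For \<open>p = 0\<close> the maximum is over the empty set, but the bound is
    then vacuous.\<close>
  have "\<exists>p'. q \<bullet>\<^sub>y p' = p" for p
    by (rule solve[of p "Suc (Max (total_deg ` keys p))"]) (auto simp: less_Suc_eq_le)
  then show ?thesis by (metis surjI)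
qed


section \<open>Factorization of the operators between lattice points\<close>

text \<open>Factors are indexed by the absolute position \<open>k\<close> on axis \<open>j\<close>.
  The factors of \<open>d_op\<close> then fill an integer interval, and operators compose by gluing
  intervals.\<close>

definition lin_fac :: "complex^'n \<Rightarrow> 'n \<Rightarrow> int \<Rightarrow> 'n mpoly"
  where "lin_fac v j k = mvar j + mconst (v $ j + of_int k)"

text \<open>A factor has zero constant term only when it is the bare variable; exactly that factor
  is replaced by 1.\<close>

definition reg_fac :: "complex^'n \<Rightarrow> 'n \<Rightarrow> int \<Rightarrow> 'n mpoly"
  where "reg_fac v j k = (if v $ j + of_int k = 0 then 1 else lin_fac v j k)"

definition d_reg :: "complex^'n::finite \<Rightarrow> int^'n \<Rightarrow> int^'n \<Rightarrow> 'n mpoly"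
  where "d_reg v u' u = (\<Prod>j\<in>UNIV. \<Prod>k\<in>{u' $ j<..u $ j}. reg_fac v j k)"

lemma d_op_eq: "d_op v u' u = (\<Prod>j\<in>UNIV. \<Prod>k\<in>{u' $ j<..u $ j}. lin_fac v j k)"
  unfolding d_op_def
proof (rule prod.cong[OF refl])
  fix j
  show "(\<Prod>\<mu>\<in>{1..u $ j - u' $ j}. mvar j + mconst (v $ j + of_int (u $ j) - of_int \<mu> + 1)) =
      (\<Prod>k\<in>{u' $ j<..u $ j}. lin_fac v j k)"
    by (rule prod.reindex_bij_witness[of _ "\<lambda>k. u $ j - k + 1" "\<lambda>\<mu>. u $ j - \<mu> + 1"])
      (auto simp: lin_fac_def algebra_simps)
qed

text \<open>Negativity of an integral entry means that the zero of v_j + k lies strictly above u_j.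
  This locates it relative to the intervals in \<open>d_op_eq\<close>.\<close>

lemma neg_supp_iff: "j \<in> neg_supp v u \<longleftrightarrow> (\<exists>k. v $ j + of_int k = 0 \<and> u $ j < k)"
proof
  assume "j \<in> neg_supp v u"
  then obtain k where "k < 0" "v $ j + of_int (u $ j) = of_int k"
    by (auto simp: neg_supp_def shift_def)
  then have "v $ j + of_int (u $ j - k) = 0 \<and> u $ j < u $ j - k" by (simp add: add_diff_eq)
  then show "\<exists>k. v $ j + of_int k = 0 \<and> u $ j < k" ..
next
  assume "\<exists>k. v $ j + of_int k = 0 \<and> u $ j < k"
  then obtain k where k: "v $ j + of_int k = 0" "u $ j < k" by blast
  then have "v $ j = - of_int k" by (simp add: eq_neg_iff_add_eq_0)
  then have "u $ j - k < 0 \<and> shift v u $ j = of_int (u $ j - k)" using k by (simp add: shift_def)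
  then show "j \<in> neg_supp v u" unfolding neg_supp_def by blast
qed

text \<open>The position \<open>k\<close> with v_j + k = 0 is unique if it exists. It lies above
  u'_j and not above u_j exactly when \<open>j\<close> is in the negative support of
  \<open>u'\<close> but not of \<open>u\<close>; it then contributes the factor
  \<open>mvar j\<close>.\<close>

lemma d_op_factor: "d_op v u' u = d_reg v u' u * mvar_prod (neg_supp v u' - neg_supp v u)"
proof -
  let ?S = "neg_supp v u' - neg_supp v u"
  have "(\<Prod>k\<in>{u' $ j<..u $ j}. lin_fac v j k) =
      (\<Prod>k\<in>{u' $ j<..u $ j}. reg_fac v j k) * (if j \<in> ?S then mvar j else 1)" for j
  proof (cases "j \<in> ?S")
    case True
    then obtain k where k: "v $ j + of_int k = 0" "u' $ j < k" "k \<le> u $ j"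
      by (auto simp: neg_supp_iff not_less)
    have "(\<Prod>l\<in>{u' $ j<..u $ j} - {k}. lin_fac v j l) =
        (\<Prod>l\<in>{u' $ j<..u $ j} - {k}. reg_fac v j l)"
    proof (rule prod.cong[OF refl])
      fix l assume "l \<in> {u' $ j<..u $ j} - {k}"
      then have "v $ j + of_int l \<noteq> 0" using k(1) by (metis DiffD2 add_left_cancel of_int_eq_iff singletonI)
      then show "lin_fac v j l = reg_fac v j l" by (simp add: reg_fac_def)
    qed
    then have "(\<Prod>l\<in>insert k ({u' $ j<..u $ j} - {k}). lin_fac v j l) =
        (\<Prod>l\<in>insert k ({u' $ j<..u $ j} - {k}). reg_fac v j l) * mvar j"
      using k(1) by (simp add: reg_fac_def[of v j k] lin_fac_def[of v j k] mconst_0 mult.commute del: insert_Diff_single)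
    moreover have "insert k ({u' $ j<..u $ j} - {k}) = {u' $ j<..u $ j}" using k by auto
    ultimately show ?thesis using True by simp
  next
    case False
    have "v $ j + of_int k \<noteq> 0" if "u' $ j < k" "k \<le> u $ j" for k
    proof
      assume *: "v $ j + of_int k = 0"
      then have "j \<in> neg_supp v u'" using that by (auto simp: neg_supp_iff)
      with False obtain l where "v $ j + of_int l = 0" "u $ j < l" by (auto simp: neg_supp_iff)
      with * have "l = k" by (metis add_left_cancel of_int_eq_iff)
      then show False using \<open>u $ j < l\<close> that by simp
    qed
    then show ?thesis using False by (auto simp: reg_fac_def intro!: prod.cong)
  qed
  then show ?thesis
    by (simp add: d_op_eq d_reg_def mvar_prod_def prod.distrib prod.If_cases set_diff_eq)
qed

lemma d_reg_const: "lookup (d_reg v u' u) 0 \<noteq> 0"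
proof -
  have "lookup (reg_fac v j k) 0 \<noteq> 0" for j k
  proof -
    have "single j 1 \<noteq> (0 :: 'a \<Rightarrow>\<^sub>0 nat)"
      by (metis lookup_single_eq lookup_zero zero_neq_one)
    then show ?thesis
      by (simp add: reg_fac_def lin_fac_def lookup_add mvar_def mconst_def lookup_single when_def lookup_one)
  qed
  then show ?thesis by (simp add: d_reg_def lookup_prod_0)
qed

text \<open>Multiplying by a variable shifts exponents, hence is injective. Cancelling the variables
  one by one gives the uniqueness behind \<open>dtilde\<close>.\<close>

lemma mvar_prod_cancel:
  assumes "q * mvar_prod S = q' * mvar_prod S"
  shows "q = q'"
proof -
  have shift: "lookup (f * mvar j) (b + single j 1) = lookup f b" for f :: "'a mpoly" and j b
    by (induction f rule: mpoly_induct)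
      (simp_all add: mvar_def mult_single lookup_single lookup_add distrib_right when_def)
  have "q = q'" if "q * prod mvar S = q' * prod mvar S" for q q' :: "'a mpoly"
    using finite[of S] that
  proof (induction S arbitrary: q q')
    case (insert j F)
    then have "q * mvar j = q' * mvar j" by (simp add: mult.assoc[symmetric])
    then show ?case by (intro poly_mapping_eqI) (metis shift)
  qed simp
  then show ?thesis using assms by (simp add: mvar_prod_def)
qed

lemma dtilde_eq: "dtilde v u' u = d_reg v u' u"
  unfolding dtilde_def
  by (rule the_equality) (auto simp: d_reg_const d_op_factor intro: mvar_prod_cancel[OF sym])

text \<open>For every ordering of \<open>a\<close>, \<open>b\<close>, \<open>c\<close>, both sides
  are the product of \<open>h\<close> over the interval from the least to the greatest of
  them.\<close>

lemma prod_interval_cocycle: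
  fixes h :: "int \<Rightarrow> 'a::comm_monoid_mult"
  shows "prod h {a<..b} * prod h {b<..c} * prod h {c<..a} =
    prod h {b<..a} * prod h {c<..b} * prod h {a<..c}"
proof -
  have split: "prod h {x<..z} = prod h {x<..y} * prod h {y<..z}" if "x \<le> y" "y \<le> z" for x y z
  proof -
    have "{x<..z} = {x<..y} \<union> {y<..z}" using that by auto
    then show ?thesis by (simp add: prod.union_disjoint)
  qed
  consider "a \<le> b" "b \<le> c" | "a \<le> c" "c \<le> b" | "b \<le> a" "a \<le> c" | "b \<le> c" "c \<le> a"
    | "c \<le> a" "a \<le> b" | "c \<le> b" "b \<le> a" by linarith
  then show ?thesis
    by cases (simp_all add: split[of a b c] split[of a c b] split[of b a c] split[of b c a]
        split[of c a b] split[of c b a] mult_ac)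
qed

lemma d_reg_cocycle: "d_reg v a b * d_reg v b c * d_reg v c a = d_reg v b a * d_reg v c b * d_reg v a c"
  unfolding d_reg_def prod.distrib[symmetric] by (intro prod.cong refl prod_interval_cocycle)

text \<open>Surjectivity makes \<open>inv\<close> a right inverse, so the inverse in the definition
  of the normalized coefficient can be cleared.\<close>

lemma d_reg_normalized_coeff: "d_reg v u 0 \<bullet>\<^sub>y normalized_coeff v r u = d_reg v 0 u \<bullet>\<^sub>y r u"
  unfolding normalized_coeff_def dtilde_eq
  by (rule surj_f_inv_f[OF diff_act_surj[OF d_reg_const]])

text \<open>Both sides are compared after applying the automorphism \<open>d\<^bsub>0\<leftarrow>u\<^esub> d\<^bsub>0\<leftarrow>u'\<^esub>\<close>; the cocycle
  identity makes the remaining unit factors agree.\<close>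

lemma d_op_relation_iff:
  fixes r v
  defines "c \<equiv> normalized_coeff v r"
  shows "d_op v u' u \<bullet>\<^sub>y r u = d_op v u u' \<bullet>\<^sub>y r u' \<longleftrightarrow>
    mvar_prod (neg_supp v u' - neg_supp v u) \<bullet>\<^sub>y c u = mvar_prod (neg_supp v u - neg_supp v u') \<bullet>\<^sub>y c u'"
proof -
  define D where "D = d_reg v 0 u * d_reg v 0 u'"
  define K where "K = d_reg v u' u * d_reg v u 0 * d_reg v 0 u'"
  have K': "K = d_reg v u u' * d_reg v u' 0 * d_reg v 0 u"
    unfolding K_def by (subst d_reg_cocycle) (simp add: mult_ac)
  have const: "lookup D 0 \<noteq> 0" "lookup K 0 \<noteq> 0"
    by (simp_all add: D_def K_def lookup_mult_0 d_reg_const)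
  \<comment> \<open>Here \<open>r s\<close> is traded for \<open>c s\<close>: the factor
    \<open>d_reg v 0 s\<close> acting on \<open>r s\<close> becomes \<open>d_reg v s 0\<close>
    acting on \<open>c s\<close>.\<close>
  have side: "(d_reg v 0 s * d_reg v 0 t) \<bullet>\<^sub>y d_op v t s \<bullet>\<^sub>y r s =
      (d_reg v t s * d_reg v s 0 * d_reg v 0 t) \<bullet>\<^sub>y mvar_prod (neg_supp v t - neg_supp v s) \<bullet>\<^sub>y c s" for s t
  proof -
    let ?P = "mvar_prod (neg_supp v t - neg_supp v s)"
    have "(d_reg v 0 s * d_reg v 0 t) \<bullet>\<^sub>y d_op v t s \<bullet>\<^sub>y r s =
        (d_reg v t s * d_reg v 0 t * ?P * d_reg v 0 s) \<bullet>\<^sub>y r s"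
      by (simp add: diff_act_mult[symmetric] d_op_factor mult_ac)
    also have "\<dots> = (d_reg v t s * d_reg v 0 t * ?P) \<bullet>\<^sub>y d_reg v s 0 \<bullet>\<^sub>y c s"
      by (simp add: diff_act_mult c_def d_reg_normalized_coeff)
    also have "\<dots> = (d_reg v t s * d_reg v s 0 * d_reg v 0 t) \<bullet>\<^sub>y ?P \<bullet>\<^sub>y c s"
      by (simp add: diff_act_mult[symmetric] mult_ac)
    finally show ?thesis .
  qed
  have "d_op v u' u \<bullet>\<^sub>y r u = d_op v u u' \<bullet>\<^sub>y r u' \<longleftrightarrow>
      D \<bullet>\<^sub>y d_op v u' u \<bullet>\<^sub>y r u = D \<bullet>\<^sub>y d_op v u u' \<bullet>\<^sub>y r u'"
    using const(1) by (simp add: diff_act_cancel)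
  also have "\<dots> \<longleftrightarrow> K \<bullet>\<^sub>y mvar_prod (neg_supp v u' - neg_supp v u) \<bullet>\<^sub>y c u =
      K \<bullet>\<^sub>y mvar_prod (neg_supp v u - neg_supp v u') \<bullet>\<^sub>y c u'"
    using side[of u u'] side[of u' u] by (simp add: D_def K_def[symmetric] K'[symmetric] mult.commute[of "d_reg v 0 u'"])
  also have "\<dots> \<longleftrightarrow> mvar_prod (neg_supp v u' - neg_supp v u) \<bullet>\<^sub>y c u =
      mvar_prod (neg_supp v u - neg_supp v u') \<bullet>\<^sub>y c u'"
    using const(2) by (simp add: diff_act_cancel)
  finally show ?thesis .
qed

text \<open>\<open>q\<close> commutes with the injective regular parts relating \<open>r u\<close>
  to its normalized coefficient. This serves for the Euler forms and, with \<open>q = 1\<close>, for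
  vanishing coefficients.\<close>

lemma diff_act_normalized_coeff_eq_0_iff:
  "q \<bullet>\<^sub>y normalized_coeff v r u = 0 \<longleftrightarrow> q \<bullet>\<^sub>y r u = 0"
proof -
  have "q \<bullet>\<^sub>y normalized_coeff v r u = 0 \<longleftrightarrow> d_reg v u 0 \<bullet>\<^sub>y q \<bullet>\<^sub>y normalized_coeff v r u = 0"
    by (simp add: diff_act_eq_0_iff d_reg_const)
  also have "\<dots> \<longleftrightarrow> d_reg v 0 u \<bullet>\<^sub>y q \<bullet>\<^sub>y r u = 0"
    by (metis diff_act_commute d_reg_normalized_coeff)
  also have "\<dots> \<longleftrightarrow> q \<bullet>\<^sub>y r u = 0"
    by (simp add: diff_act_eq_0_iff d_reg_const)
  finally show ?thesis .
qed


section \<open>The action of the hypergeometric ideal\<close>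

lemma weyl_act_0: "weyl_act 0 \<phi> v = 0"
  by transfer (rule free_act_0)

lemma weyl_act_1: "weyl_act 1 \<phi> = \<phi>"
  by transfer (rule free_act_1)

lemma weyl_act_zero_series: "weyl_act P (\<lambda>v. 0) = (\<lambda>v. 0)"
  by transfer (rule ext, rule free_act_zero_series)

lemma weyl_act_uminus: "weyl_act (- P) \<phi> v = - weyl_act P \<phi> v"
  using weyl_act_add[of P "- P" \<phi> v] by (simp add: weyl_act_0 eq_neg_iff_add_eq_0 add.commute)

lemma weyl_act_diff: "weyl_act (P - Q) \<phi> v = weyl_act P \<phi> v - weyl_act Q \<phi> v"
  using weyl_act_add[of P "- Q" \<phi> v] by (simp add: weyl_act_uminus)

lemma weyl_act_sum: "weyl_act (sum h S) \<phi> v = (\<Sum>s\<in>S. weyl_act (h s) \<phi> v)"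
  by (induction S rule: infinite_finite_induct) (simp_all add: weyl_act_0 weyl_act_add)

lemma weyl_act_const: "weyl_act (weyl_const c) \<phi> v = mconst c * \<phi> v"
proof (transfer fixing: c)
  fix \<phi> :: "'a log_series" and v
  show "free_act (single 0 c) \<phi> v = mconst c * \<phi> v"
    by (simp add: free_act_single word_act_def zero_free_monoid_def)
qed

lemma weyl_act_of_int: "weyl_act (of_int k) \<phi> v = mconst (of_int k) * \<phi> v"
proof -
  have *: "weyl_act (of_nat n) \<phi> v = mconst (of_nat n) * \<phi> v" for n
    by (induction n) (simp_all add: weyl_act_0 weyl_act_1 weyl_act_add mconst_0 mconst_1 mconst_add algebra_simps)
  show ?thesis
  proof (cases k)
    case (nonneg n)
    then show ?thesis using *[of n] by simp
  next
    case (neg n)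
    have minus: "mconst (- c) = - mconst c" for c :: complex
      using mconst_diff[of 0 c] by (simp add: mconst_0)
    show ?thesis
      unfolding neg of_int_minus of_int_of_nat_eq weyl_act_uminus * minus by simp
  qed
qed

lemma weyl_act_theta: "weyl_act (weyl_theta j) \<phi> v = mconst (v $ j) * \<phi> v + mpderiv j (\<phi> v)"
  by (simp add: weyl_theta_def weyl_act_mult weyl_act_x weyl_act_d)

text \<open>The operators annihilating a fixed series form a left ideal.\<close>

lemma annihilated_by_left_ideal_hull:
  "annihilated_by \<phi> (left_ideal hull S) \<longleftrightarrow> annihilated_by \<phi> S"
proof
  assume "annihilated_by \<phi> S"
  moreover have "left_ideal {P. weyl_act P \<phi> = (\<lambda>v. 0)}"
    by (auto simp: left_ideal_def fun_eq_iff weyl_act_0 weyl_act_add weyl_act_mult)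
      (auto simp: weyl_act_zero_series simp flip: fun_eq_iff)
  ultimately show "annihilated_by \<phi> (left_ideal hull S)"
    using hull_minimal[of S "{P. weyl_act P \<phi> = (\<lambda>v. 0)}" left_ideal]
    by (auto simp: annihilated_by_def)
qed (auto simp: annihilated_by_def hull_inc)

text \<open>\<open>\<partial>\<^sup>a (x\<^bsup>v + a\<^esup> r(log x)) = x\<^sup>v (d_mono v a \<bullet> r)(log x)\<close>.\<close>

definition d_mono :: "complex^'n::finite \<Rightarrow> ('n \<Rightarrow>\<^sub>0 nat) \<Rightarrow> 'n mpoly"
  where "d_mono v a = (\<Prod>j\<in>UNIV. \<Prod>m<lookup a j. mvar j + mconst (v $ j + of_nat (Suc m)))"

definition exp_vec :: "('n \<Rightarrow>\<^sub>0 nat) \<Rightarrow> complex^'n::finite"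
  where "exp_vec a = (\<chi> j. of_nat (lookup a j))"

lemma exp_vec_add: "exp_vec (a + b) = exp_vec a + exp_vec b"
  by (simp add: exp_vec_def vec_eq_iff lookup_add)

text \<open>The derivatives of exponent \<open>b\<close> act first and lead from v + a + b to v + a,
  which is why their base point is displaced by \<open>a\<close>.\<close>

lemma d_mono_add: "d_mono v (a + b) = d_mono v a * d_mono (v + exp_vec a) b"
proof -
  have "(\<Prod>m<k + l. h m) = (\<Prod>m<k. h m) * (\<Prod>m<l. h (k + m))" for k l and h :: "nat \<Rightarrow> 'a mpoly"
    by (induction l) (simp_all add: mult.assoc)
  then show ?thesis
    by (simp add: d_mono_def lookup_add exp_vec_def prod.distrib add_ac)
qed

text \<open>Each derivation contributes one linear factor and one unit of index shift; peeling off
  the outermost one gives the factor with offset 1.\<close>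

lemma weyl_act_d_power:
  "weyl_act (weyl_d j ^ k) \<phi> v =
    (\<Prod>m<k. mvar j + mconst (v $ j + of_nat (Suc m))) \<bullet>\<^sub>y \<phi> (v + axis j (of_nat k))"
proof (induction k arbitrary: v)
  case 0
  have "axis j (0 :: complex) = 0" by (simp add: axis_def vec_eq_iff)
  then show ?case by (simp add: weyl_act_1 del: axis_eq_0_iff)
next
  case (Suc k)
  have "weyl_act (weyl_d j ^ Suc k) \<phi> v =
      (mvar j + mconst (v $ j + 1)) \<bullet>\<^sub>y weyl_act (weyl_d j ^ k) \<phi> (v + axis j 1)"
    by (simp add: weyl_act_mult weyl_act_d diff_act_add_left diff_act_mconst diff_act_mvar add.commute)
  also have "\<dots> = ((mvar j + mconst (v $ j + 1)) *
      (\<Prod>m<k. mvar j + mconst (v $ j + of_nat (Suc (Suc m))))) \<bullet>\<^sub>y \<phi> (v + axis j 1 + axis j (of_nat k))"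
    by (simp add: Suc diff_act_mult axis_def add_ac)
  also have "(mvar j + mconst (v $ j + 1)) * (\<Prod>m<k. mvar j + mconst (v $ j + of_nat (Suc (Suc m)))) =
      (\<Prod>m<Suc k. mvar j + mconst (v $ j + of_nat (Suc m)))"
    by (subst prod.lessThan_Suc_shift) simp
  also have "v + axis j 1 + axis j (of_nat k) = v + axis j (of_nat (Suc k))"
    by (simp add: axis_def vec_eq_iff)
  finally show ?case .
qed

text \<open>A shift in coordinate \<open>i\<close> leaves the linear factors of the other
  coordinates unchanged, so the one-variable formulas multiply.\<close>

lemma weyl_act_d_monomial:
  "weyl_act (Finite_Set.fold (\<lambda>j. (*) (weyl_d j ^ lookup a j)) 1 UNIV) \<phi> v =
    d_mono v a \<bullet>\<^sub>y \<phi> (v + exp_vec a)"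
proof -
  interpret comp_fun_commute "\<lambda>j. (*) (weyl_d j ^ lookup a j :: 'a weyl)"
  proof
    fix i j
    have "weyl_d i ^ k * weyl_d j ^ l = weyl_d j ^ l * (weyl_d i ^ k :: 'a weyl)" for k l
      by (metis power_commuting_commutes weyl_d_commute)
    then show "(*) (weyl_d i ^ lookup a i) \<circ> (*) (weyl_d j ^ lookup a j :: 'a weyl) =
        (*) (weyl_d j ^ lookup a j) \<circ> (*) (weyl_d i ^ lookup a i)"
      by (simp add: fun_eq_iff mult.assoc[symmetric])
  qed
  have "weyl_act (Finite_Set.fold (\<lambda>j. (*) (weyl_d j ^ lookup a j)) 1 F) \<phi> v =
      (\<Prod>j\<in>F. \<Prod>m<lookup a j. mvar j + mconst (v $ j + of_nat (Suc m))) \<bullet>\<^sub>y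
        \<phi> (v + (\<chi> j. if j \<in> F then of_nat (lookup a j) else 0))" if "finite F" for F
    using that
  proof (induction F arbitrary: v)
    case empty
    have "(\<chi> j. 0) = (0 :: complex^'a)" by (simp add: vec_eq_iff)
    then show ?case by (simp add: weyl_act_1)
  next
    case (insert i F)
    have v: "v + axis i (of_nat (lookup a i)) + (\<chi> j. if j \<in> F then of_nat (lookup a j) else 0) =
        v + (\<chi> j. if j \<in> insert i F then of_nat (lookup a j) else 0)"
      using insert.hyps by (auto simp: axis_def vec_eq_iff)
    have P: "(\<Prod>j\<in>F. \<Prod>m<lookup a j. mvar j + mconst ((v + axis i (of_nat (lookup a i))) $ j + of_nat (Suc m))) =
        (\<Prod>j\<in>F. \<Prod>m<lookup a j. mvar j + mconst (v $ j + of_nat (Suc m)))"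
      using insert.hyps by (intro prod.cong) (auto simp: axis_def)
    show ?case
      unfolding fold_insert[OF insert.hyps] weyl_act_mult weyl_act_d_power insert.IH v P
      by (simp only: prod.insert[OF insert.hyps] diff_act_mult)
  qed
  from this[of UNIV] show ?thesis by (simp add: d_mono_def exp_vec_def)
qed

text \<open>The action is restated on commutative polynomials so that the ideal argument for
  \<open>toric_ideal\<close> takes place in the commutative ring.\<close>

definition poly_d_act :: "'n::finite mpoly \<Rightarrow> 'n log_series \<Rightarrow> 'n log_series"
  where "poly_d_act f \<phi> v = (\<Sum>a\<in>keys f. mconst (lookup f a) * (d_mono v a \<bullet>\<^sub>y \<phi> (v + exp_vec a)))"

lemma weyl_act_subst_d: "weyl_act (weyl_subst weyl_d f) \<phi> = poly_d_act f \<phi>"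
  by (rule ext)
    (simp add: weyl_subst_def poly_d_act_def weyl_act_sum weyl_act_mult weyl_act_const weyl_act_d_monomial)

lemma poly_d_act_0: "poly_d_act 0 \<phi> v = 0"
  by (simp add: poly_d_act_def)

lemma poly_d_act_add: "poly_d_act (f + g) \<phi> v = poly_d_act f \<phi> v + poly_d_act g \<phi> v"
  unfolding poly_d_act_def
  by (rule setsum_keys_plus_distrib) (simp_all add: mconst_0 mconst_add algebra_simps)

lemma poly_d_act_single: "poly_d_act (single a c) \<phi> v = mconst c * (d_mono v a \<bullet>\<^sub>y \<phi> (v + exp_vec a))"
  by (cases "c = 0") (simp_all add: poly_d_act_def mconst_0)

lemma poly_d_act_mult: "poly_d_act (h * f) \<phi> v = poly_d_act h (poly_d_act f \<phi>) v"
proof (induction h rule: mpoly_induct)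
  case (monom a c)
  show ?case
  proof (induction f rule: mpoly_induct)
    case zero
    then show ?case by (simp add: poly_d_act_0 poly_d_act_single)
  next
    case (monom a' c')
    then show ?case
      by (simp add: mult_single poly_d_act_single d_mono_add exp_vec_add mconst_mult
          diff_act_mult diff_act_mconst_mult_right mult.assoc add.assoc)
  next
    case (add f g)
    then show ?case
      by (simp add: distrib_left poly_d_act_add poly_d_act_single diff_act_add_right)
  qed
qed (simp_all add: poly_d_act_0 poly_d_act_add distrib_right)

lemma poly_d_act_zero_series: "poly_d_act f (\<lambda>v. 0) v = 0"
  by (simp add: poly_d_act_def)

lemma poly_d_act_binomial:
  "poly_d_act (mmonom a - mmonom b) \<phi> v =
    d_mono v a \<bullet>\<^sub>y \<phi> (v + exp_vec a) - d_mono v b \<bullet>\<^sub>y \<phi> (v + exp_vec b)"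
  using poly_d_act_add[of "mmonom a - mmonom b" "mmonom b" \<phi> v]
  by (simp add: mmonom_def poly_d_act_single mconst_1)

definition int_vec :: "('n \<Rightarrow>\<^sub>0 nat) \<Rightarrow> int^'n::finite"
  where "int_vec a = (\<chi> j. int (lookup a j))"

text \<open>The polynomials acting as zero on the series form an ideal, so only the generating
  binomials have to be tested.\<close>

lemma annihilated_by_toric_iff:
  "annihilated_by \<phi> (weyl_subst weyl_d ` toric_ideal A) \<longleftrightarrow>
    (\<forall>a b. A *v int_vec a = A *v int_vec b \<longrightarrow>
      (\<forall>v. d_mono v a \<bullet>\<^sub>y \<phi> (v + exp_vec a) = d_mono v b \<bullet>\<^sub>y \<phi> (v + exp_vec b)))"
  (is "?L \<longleftrightarrow> ?R")
proof -
  let ?K = "{f. poly_d_act f \<phi> = (\<lambda>v. 0)}"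
  let ?S = "{mmonom a - mmonom b | a b. A *v int_vec a = A *v int_vec b}"
  have toric: "toric_ideal A = left_ideal hull ?S"
    by (simp add: toric_ideal_def int_vec_def)
  have "left_ideal ?K"
    unfolding left_ideal_def
  proof (intro conjI ballI allI)
    fix h f assume "f \<in> ?K"
    then show "h * f \<in> ?K" by (simp add: fun_eq_iff[of "poly_d_act (h * f) \<phi>"] poly_d_act_mult poly_d_act_zero_series)
  qed (auto simp: fun_eq_iff poly_d_act_0 poly_d_act_add)
  then have "left_ideal hull ?S \<subseteq> ?K \<longleftrightarrow> ?S \<subseteq> ?K"
    by (meson hull_subset hull_minimal subset_trans)
  then have "?L \<longleftrightarrow> ?S \<subseteq> ?K"
    by (auto simp: annihilated_by_def weyl_act_subst_d toric)
  also have "\<dots> \<longleftrightarrow> (\<forall>a b. A *v int_vec a = A *v int_vec b \<longrightarrow> poly_d_act (mmonom a - mmonom b) \<phi> = (\<lambda>v. 0))"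
    by blast
  also have "\<dots> \<longleftrightarrow> ?R"
    unfolding fun_eq_iff poly_d_act_binomial right_minus_eq ..
  finally show ?thesis .
qed

section \<open>Toric relations along the shifted lattice\<close>

lemma shift_inject: "shift v u = shift v u' \<longleftrightarrow> u = u'"
  by (simp add: shift_def vec_eq_iff)

lemma shift_add_exp_vec: "shift v u + exp_vec a = shift v (u + int_vec a)"
  by (simp add: shift_def exp_vec_def int_vec_def vec_eq_iff)

lemma d_mono_shift: "d_mono (shift v u) a = d_op v u (u + int_vec a)"
  unfolding d_op_eq d_mono_def
proof (rule prod.cong[OF refl])
  fix j
  \<comment> \<open>The factor with index \<open>m\<close>, counted from 0, sits at position u_j + m
    + 1.\<close>
  show "(\<Prod>m<lookup a j. mvar j + mconst (shift v u $ j + of_nat (Suc m))) =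
      (\<Prod>k\<in>{u $ j<..(u + int_vec a) $ j}. lin_fac v j k)"
    by (rule prod.reindex_bij_witness[of _ "\<lambda>k. nat (k - u $ j - 1)" "\<lambda>m. u $ j + int (Suc m)"])
      (auto simp: lin_fac_def shift_def int_vec_def algebra_simps)
qed

lemma d_op_trans:
  assumes "\<And>j. p $ j \<le> q $ j" "\<And>j. q $ j \<le> u $ j"
  shows "d_op v p u = d_op v p q * d_op v q u"
proof -
  have "prod f {p $ j<..u $ j} = prod f {p $ j<..q $ j} * prod f {q $ j<..u $ j}" for j and f :: "int \<Rightarrow> 'a mpoly"
  proof -
    have "{p $ j<..u $ j} = {p $ j<..q $ j} \<union> {q $ j<..u $ j}" using assms[of j] by auto
    then show ?thesis by (simp add: prod.union_disjoint)
  qed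
  then show ?thesis by (simp add: d_op_eq prod.distrib)
qed

definition vec_min :: "int^'n \<Rightarrow> int^'n \<Rightarrow> int^'n"
  where "vec_min u u' = (\<chi> j. min (u $ j) (u' $ j))"

text \<open>\<open>d_op\<close> only moves downwards: coordinates that would have to grow contribute
  an empty product.\<close>

lemma d_op_vec_min: "d_op v (vec_min u u') u = d_op v u' u" "d_op v (vec_min u u') u' = d_op v u u'"
proof -
  have "{min a b<..a} = {b<..a}" "{min a b<..b} = {a<..b}" for a b :: int by auto
  then show "d_op v (vec_min u u') u = d_op v u' u" "d_op v (vec_min u u') u' = d_op v u u'"
    by (simp_all add: d_op_eq vec_min_def)
qed

lemma int_vec_surj:
  assumes "\<And>j. p $ j \<le> u $ j"
  obtains a where "u = p + int_vec a"
proof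
  show "u = p + int_vec (Abs_poly_mapping (\<lambda>j. nat (u $ j - p $ j)))"
    using assms by (simp add: int_vec_def vec_eq_iff)
qed

text \<open>A binomial \<open>\<partial>\<^sup>a - \<partial>\<^sup>b\<close> links only the coefficients at \<open>u\<close> and \<open>u' = u - a + b\<close>, and it is a
  multiple of the one with \<open>a = (u - u')\<^sup>+\<close> and \<open>b = (u' - u)\<^sup>+\<close>.\<close>

lemma toric_relations_iff:
  assumes on: "\<And>u. u \<in> ker_lattice A \<Longrightarrow> \<phi> (shift v\<^sub>0 u) = r u"
    and off: "\<And>v. v \<notin> shift v\<^sub>0 ` ker_lattice A \<Longrightarrow> \<phi> v = 0"
  shows "annihilated_by \<phi> (weyl_subst weyl_d ` toric_ideal A) \<longleftrightarrow>
    (\<forall>u\<in>ker_lattice A. \<forall>u'\<in>ker_lattice A. d_op v\<^sub>0 u' u \<bullet>\<^sub>y r u = d_op v\<^sub>0 u u' \<bullet>\<^sub>y r u')"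
  unfolding annihilated_by_toric_iff
proof (intro iffI ballI allI impI)
  fix u u'
  assume rel: "\<forall>a b. A *v int_vec a = A *v int_vec b \<longrightarrow>
      (\<forall>v. d_mono v a \<bullet>\<^sub>y \<phi> (v + exp_vec a) = d_mono v b \<bullet>\<^sub>y \<phi> (v + exp_vec b))"
    and L: "u \<in> ker_lattice A" "u' \<in> ker_lattice A"
  let ?m = "vec_min u u'"
  obtain a where a: "u = ?m + int_vec a" by (rule int_vec_surj[of ?m u]) (auto simp: vec_min_def)
  obtain b where b: "u' = ?m + int_vec b" by (rule int_vec_surj[of ?m u']) (auto simp: vec_min_def)
  have "A *v ?m + A *v int_vec a = A *v ?m + A *v int_vec b"
    using L unfolding matrix_vector_right_distrib[symmetric] a[symmetric] b[symmetric]
    by (simp add: ker_lattice_def)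
  then have "A *v int_vec a = A *v int_vec b" by (rule add_left_imp_eq)
  with rel have "d_mono (shift v\<^sub>0 ?m) a \<bullet>\<^sub>y \<phi> (shift v\<^sub>0 ?m + exp_vec a) =
      d_mono (shift v\<^sub>0 ?m) b \<bullet>\<^sub>y \<phi> (shift v\<^sub>0 ?m + exp_vec b)"
    by blast
  then show "d_op v\<^sub>0 u' u \<bullet>\<^sub>y r u = d_op v\<^sub>0 u u' \<bullet>\<^sub>y r u'"
    unfolding d_mono_shift shift_add_exp_vec a[symmetric] b[symmetric] d_op_vec_min on[OF L(1)] on[OF L(2)] .
next
  fix a b v
  assume rel: "\<forall>u\<in>ker_lattice A. \<forall>u'\<in>ker_lattice A. d_op v\<^sub>0 u' u \<bullet>\<^sub>y r u = d_op v\<^sub>0 u u' \<bullet>\<^sub>y r u'"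
    and ab: "A *v int_vec a = A *v int_vec b"
  have L_iff: "p + int_vec a \<in> ker_lattice A \<longleftrightarrow> p + int_vec b \<in> ker_lattice A" for p
    using ab by (simp add: ker_lattice_def matrix_vector_right_distrib)
  show "d_mono v a \<bullet>\<^sub>y \<phi> (v + exp_vec a) = d_mono v b \<bullet>\<^sub>y \<phi> (v + exp_vec b)"
  \<comment> \<open>What matters is whether the endpoints p + a and p + b lie in the lattice, which
    by \<open>L_iff\<close> happens together; the base point \<open>p\<close> itself may lie outside
    it.\<close>
  proof (cases "\<exists>p. v = shift v\<^sub>0 p \<and> p + int_vec a \<in> ker_lattice A")
    case True
    then obtain p where p: "v = shift v\<^sub>0 p" and L: "p + int_vec a \<in> ker_lattice A" by blast
    let ?u = "p + int_vec a" and ?u' = "p + int_vec b"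
    let ?m = "vec_min ?u ?u'"
    have L': "?u' \<in> ker_lattice A" using L L_iff by blast
    have le: "p $ j \<le> ?m $ j" "?m $ j \<le> ?u $ j" "?m $ j \<le> ?u' $ j" for j
      by (simp_all add: vec_min_def int_vec_def)
    have split: "d_op v\<^sub>0 p ?u = d_op v\<^sub>0 p ?m * d_op v\<^sub>0 ?u' ?u"
      "d_op v\<^sub>0 p ?u' = d_op v\<^sub>0 p ?m * d_op v\<^sub>0 ?u ?u'"
      unfolding d_op_trans[of p ?m ?u, OF le(1,2)] d_op_trans[of p ?m ?u', OF le(1,3)] d_op_vec_min
      by (rule refl)+
    show ?thesis
      unfolding p d_mono_shift shift_add_exp_vec on[OF L] on[OF L'] split diff_act_mult
      using rel L L' by simp
  next
    case False
    have zero: "\<phi> (v + exp_vec c) = 0" if "\<And>p. v = shift v\<^sub>0 p \<Longrightarrow> p + int_vec c \<notin> ker_lattice A" for c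
    proof (rule off, rule notI)
      assume "v + exp_vec c \<in> shift v\<^sub>0 ` ker_lattice A"
      then obtain u where u: "v + exp_vec c = shift v\<^sub>0 u" "u \<in> ker_lattice A" by blast
      have "v = shift v\<^sub>0 (u - int_vec c)"
        using u(1) shift_add_exp_vec[of v\<^sub>0 "u - int_vec c" c] by (metis add_right_cancel diff_add_cancel)
      then show False using that u(2) by fastforce
    qed
    have "\<phi> (v + exp_vec a) = 0" "\<phi> (v + exp_vec b) = 0"
      using False L_iff by (blast intro: zero)+
    then show ?thesis by simp
  qed
qed

section \<open>Euler operators and fake exponents\<close>

lemma euler_act:
  "weyl_act ((\<Sum>j\<in>UNIV. of_int (A $ i $ j) * weyl_theta j) - weyl_const (\<beta> $ i)) \<phi> v =
    (\<Sum>j\<in>UNIV. of_int (A $ i $ j) * mvar j) \<bullet>\<^sub>y \<phi> v +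
      mconst ((\<Sum>j\<in>UNIV. of_int (A $ i $ j) * v $ j) - \<beta> $ i) * \<phi> v"
proof -
  have of_int: "of_int k = mconst (of_int k)" for k by (simp add: mconst_def)
  have msum: "mconst (sum h S) = (\<Sum>s\<in>S. mconst (h s))" for h :: "'a \<Rightarrow> complex" and S
    by (induction S rule: infinite_finite_induct) (simp_all add: mconst_0 mconst_add)
  \<comment> \<open>\<open>weyl_theta j\<close> acts on the coefficient at \<open>v\<close> as v_j
    plus the derivative in y_j; collecting scalars leaves (A v)_i - beta_i.\<close>
  show ?thesis
    by (simp add: weyl_act_diff weyl_act_sum weyl_act_mult weyl_act_of_int weyl_act_theta weyl_act_const
        of_int diff_act_sum_left diff_act_mult diff_act_mconst diff_act_mvar mconst_diff msum mconst_mult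
        distrib_left left_diff_distrib sum.distrib sum_distrib_right mult.assoc)
qed

lemma meval_add: "meval (f + g) z = meval f z + meval g z"
  unfolding meval_def by (rule setsum_keys_plus_distrib) (simp_all add: algebra_simps)

lemma meval_single: "meval (single a c) z = c * (\<Prod>j\<in>UNIV. (z $ j) ^ lookup a j)"
  by (cases "c = 0") (simp_all add: meval_def)

lemma meval_sum: "meval (sum h S) z = (\<Sum>s\<in>S. meval (h s) z)"
  by (induction S rule: infinite_finite_induct) (simp_all add: meval_add, simp_all add: meval_def)

lemma meval_euler:
  "meval ((\<Sum>j\<in>UNIV. of_int (k j) * mvar j) - mconst c) z = (\<Sum>j\<in>UNIV. of_int (k j) * z $ j) - c"
proof -
  have "of_int (k j) * mvar j = single (single j 1) (of_int (k j))" for j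
    by (simp add: mvar_def mult_single flip: single_of_int)
  moreover have "(\<Prod>i\<in>UNIV. (z $ i) ^ lookup (single j 1) i) = z $ j" for j
    by (subst prod.remove[of _ j]) (auto simp: lookup_single when_def intro!: prod.neutral)
  ultimately have "meval (\<Sum>j\<in>UNIV. of_int (k j) * mvar j) z = (\<Sum>j\<in>UNIV. of_int (k j) * z $ j)"
    by (simp add: meval_sum meval_single)
  moreover have "meval (mconst c) z = c" by (simp add: mconst_def meval_single)
  ultimately show ?thesis
    using meval_add[of "(\<Sum>j\<in>UNIV. of_int (k j) * mvar j) - mconst c" "mconst c" z] by simp
qed

text \<open>Taking the first summand zero shows that the Euler generators lie in the fake indicial
  ideal, so they vanish at the fake exponent.\<close>

lemma fake_exponent_euler:
  assumes "fake_exponent A \<beta> w v\<^sub>0"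
  shows "(\<Sum>j\<in>UNIV. of_int (A $ i $ j) * v\<^sub>0 $ j) = \<beta> $ i"
proof -
  let ?e = "\<lambda>i. (\<Sum>j\<in>UNIV. of_int (A $ i $ j) * mvar j) - mconst (\<beta> $ i)"
  have "weyl_subst weyl_theta 0 \<in> left_ideal hull (weyl_subst weyl_d ` initial_ideal w (toric_ideal A))"
    using left_ideal_hull[of "weyl_subst weyl_d ` initial_ideal w (toric_ideal A)"]
    by (simp add: left_ideal_def weyl_subst_def)
  moreover have "?e i \<in> left_ideal hull range ?e" by (rule hull_inc) simp
  ultimately have "0 + ?e i \<in> fake_indicial_ideal A \<beta> w" unfolding fake_indicial_ideal_def by blast
  then show ?thesis using assms meval_euler[of "\<lambda>j. A $ i $ j"] by (fastforce simp: fake_exponent_def)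
qed

text \<open>On the shifted lattice the scalar part of the Euler operators vanishes since A u = 0;
  elsewhere the series has zero coefficients.\<close>

lemma annihilated_by_hypergeometric_iff:
  assumes on: "\<And>u. u \<in> ker_lattice A \<Longrightarrow> \<phi> (shift v\<^sub>0 u) = r u"
    and off: "\<And>v. v \<notin> shift v\<^sub>0 ` ker_lattice A \<Longrightarrow> \<phi> v = 0"
    and euler: "\<And>i. (\<Sum>j\<in>UNIV. of_int (A $ i $ j) * v\<^sub>0 $ j) = \<beta> $ i"
  shows "annihilated_by \<phi> (hypergeometric_ideal A \<beta>) \<longleftrightarrow>
    (\<forall>u\<in>ker_lattice A. \<forall>u'\<in>ker_lattice A. d_op v\<^sub>0 u' u \<bullet>\<^sub>y r u = d_op v\<^sub>0 u u' \<bullet>\<^sub>y r u') \<and>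
    (\<forall>u\<in>ker_lattice A. \<forall>i. (\<Sum>j\<in>UNIV. of_int (A $ i $ j) * mvar j) \<bullet>\<^sub>y r u = 0)"
proof -
  let ?E = "\<lambda>i. (\<Sum>j\<in>UNIV. of_int (A $ i $ j) * weyl_theta j) - weyl_const (\<beta> $ i)"
  let ?e = "\<lambda>i. (\<Sum>j\<in>UNIV. of_int (A $ i $ j) * mvar j)"
  have "(\<Sum>j\<in>UNIV. of_int (A $ i $ j) * shift v\<^sub>0 u $ j) = \<beta> $ i" if "u \<in> ker_lattice A" for u i
  proof -
    have "(\<Sum>j\<in>UNIV. A $ i $ j * u $ j) = 0"
      using that by (simp add: ker_lattice_def vec_eq_iff matrix_vector_mult_def)
    then have "(\<Sum>j\<in>UNIV. of_int (A $ i $ j) * of_int (u $ j)) = (0 :: complex)"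
      by (metis (mono_tags, lifting) of_int_0 of_int_mult of_int_sum sum.cong)
    then show ?thesis by (simp add: shift_def distrib_left sum.distrib euler)
  qed
  then have at: "weyl_act (?E i) \<phi> (shift v\<^sub>0 u) = ?e i \<bullet>\<^sub>y r u" if "u \<in> ker_lattice A" for u i
    using that by (simp add: euler_act on mconst_0)
  have "weyl_act (?E i) \<phi> = (\<lambda>v. 0) \<longleftrightarrow> (\<forall>u\<in>ker_lattice A. ?e i \<bullet>\<^sub>y r u = 0)" for i
  proof
    assume *: "\<forall>u\<in>ker_lattice A. ?e i \<bullet>\<^sub>y r u = 0"
    show "weyl_act (?E i) \<phi> = (\<lambda>v. 0)"
    proof
      fix v
      show "weyl_act (?E i) \<phi> v = 0"
      proof (cases "v \<in> shift v\<^sub>0 ` ker_lattice A")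
        case True
        then show ?thesis using * by (auto simp: at)
      next
        case False
        then show ?thesis by (simp add: euler_act off)
      qed
    qed
  next
    assume *: "weyl_act (?E i) \<phi> = (\<lambda>v. 0)"
    show "\<forall>u\<in>ker_lattice A. ?e i \<bullet>\<^sub>y r u = 0"
    proof
      fix u assume "u \<in> ker_lattice A"
      from at[OF this, of i] show "?e i \<bullet>\<^sub>y r u = 0" unfolding * by (rule sym)
    qed
  qed
  then have "annihilated_by \<phi> (range ?E) \<longleftrightarrow> (\<forall>u\<in>ker_lattice A. \<forall>i. ?e i \<bullet>\<^sub>y r u = 0)"
    by (auto simp: annihilated_by_def)
  moreover have "annihilated_by \<phi> (hypergeometric_ideal A \<beta>) \<longleftrightarrow>
      annihilated_by \<phi> (weyl_subst weyl_d ` toric_ideal A) \<and> annihilated_by \<phi> (range ?E)"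
    unfolding hypergeometric_ideal_def annihilated_by_left_ideal_hull
    by (auto simp only: annihilated_by_def Un_iff)
  ultimately show ?thesis using toric_relations_iff[of A \<phi> v\<^sub>0 r, OF on off] by simp
qed

section \<open>The series and the coefficients indexed by negative supports\<close>

lemma phi_series_shift:
  assumes "u \<in> ker_lattice A" "neg_supp v\<^sub>0 u \<notin> N \<Longrightarrow> r u = 0"
  shows "phi_series A v\<^sub>0 N r (shift v\<^sub>0 u) = r u"
proof -
  have "{u'. u' \<in> ker_lattice A \<and> neg_supp v\<^sub>0 u' \<in> N \<and> shift v\<^sub>0 u' = shift v\<^sub>0 u} =
      (if neg_supp v\<^sub>0 u \<in> N then {u} else {})"
    using assms(1) by (auto simp: shift_inject)
  then show ?thesis using assms(2) by (auto simp: phi_series_def)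
qed

lemma phi_series_off: "v \<notin> shift v\<^sub>0 ` ker_lattice A \<Longrightarrow> phi_series A v\<^sub>0 N r v = 0"
  unfolding phi_series_def by (rule sum.neutral) auto

lemma coeff_at_cases:
  assumes "I \<in> neg_supps A v\<^sub>0"
  obtains u where "u \<in> ker_lattice A" "neg_supp v\<^sub>0 u = I" "coeff_at A v\<^sub>0 c I = c u"
proof -
  have "\<exists>u. u \<in> ker_lattice A \<and> neg_supp v\<^sub>0 u = I" using assms by (auto simp: neg_supps_def)
  from someI_ex[OF this] have "(SOME u. u \<in> ker_lattice A \<and> neg_supp v\<^sub>0 u = I) \<in> ker_lattice A"
    "neg_supp v\<^sub>0 (SOME u. u \<in> ker_lattice A \<and> neg_supp v\<^sub>0 u = I) = I" by blast+
  then show ?thesis by (rule that) (simp add: coeff_at_def)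
qed

theorem proposition4p3:
  fixes A :: "int^'n::finite^'d::finite"
    and \<beta> :: "complex^'d"
    and w :: "real^'n"
    and v\<^sub>0 :: "complex^'n"
    and N :: "'n set set"
    and r c :: "int^'n \<Rightarrow> 'n mpoly"
    and cI :: "'n set \<Rightarrow> 'n mpoly"
  defines "c \<equiv> normalized_coeff v\<^sub>0 r"
    and "cI \<equiv> coeff_at A v\<^sub>0 c"
  assumes "rank (rat_matrix A) = CARD('d)"
    and "columns_on_hyperplane A"
    and "generic_weight A w"
    and "fake_exponent A \<beta> w v\<^sub>0"
    and "negative_support_family A w v\<^sub>0 N"
    and "ordered_family A v\<^sub>0 N"
    and "\<forall>u\<in>ker_lattice A. neg_supp v\<^sub>0 u \<in> neg_supps A v\<^sub>0 - N \<longrightarrow> r u = 0"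
  shows "(annihilated_by (phi_series A v\<^sub>0 N r) (hypergeometric_ideal A \<beta>) \<longleftrightarrow>
      (\<forall>u\<in>ker_lattice A. \<forall>u'\<in>ker_lattice A. neg_supp v\<^sub>0 u = neg_supp v\<^sub>0 u' \<longrightarrow> c u = c u') \<and>
      (\<forall>I\<in>neg_supps A v\<^sub>0. \<forall>i. (\<Sum>j\<in>UNIV. of_int (A $ i $ j) * mvar j) \<bullet>\<^sub>y cI I = 0) \<and>
      (\<forall>I\<in>neg_supps A v\<^sub>0. \<forall>I'\<in>neg_supps A v\<^sub>0.
        mvar_prod (I' - I) \<bullet>\<^sub>y cI I - mvar_prod (I - I') \<bullet>\<^sub>y cI I' = 0))
    \<and> ((\<forall>u\<in>ker_lattice A. \<forall>u'\<in>ker_lattice A. neg_supp v\<^sub>0 u = neg_supp v\<^sub>0 u' \<longrightarrow> c u = c u') \<longrightarrow>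
      (\<forall>I\<in>neg_supps A v\<^sub>0 - N. cI I = 0))"
proof -
  let ?L = "ker_lattice A" and ?I = "neg_supp v\<^sub>0"
  let ?e = "\<lambda>i. (\<Sum>j\<in>UNIV. of_int (A $ i $ j) * mvar j)"
  have r0: "r u = 0" if "u \<in> ?L" "?I u \<notin> N" for u
    using that assms(9) by (auto simp: neg_supps_def)
  have "annihilated_by (phi_series A v\<^sub>0 N r) (hypergeometric_ideal A \<beta>) \<longleftrightarrow>
      (\<forall>u\<in>?L. \<forall>u'\<in>?L. d_op v\<^sub>0 u' u \<bullet>\<^sub>y r u = d_op v\<^sub>0 u u' \<bullet>\<^sub>y r u') \<and>
      (\<forall>u\<in>?L. \<forall>i. ?e i \<bullet>\<^sub>y r u = 0)"
    by (rule annihilated_by_hypergeometric_iff)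
      (auto simp: phi_series_shift phi_series_off r0 fake_exponent_euler[OF assms(6)])
  also have "\<dots> \<longleftrightarrow>
      (\<forall>u\<in>?L. \<forall>u'\<in>?L. mvar_prod (?I u' - ?I u) \<bullet>\<^sub>y c u = mvar_prod (?I u - ?I u') \<bullet>\<^sub>y c u') \<and>
      (\<forall>u\<in>?L. \<forall>i. ?e i \<bullet>\<^sub>y c u = 0)"
    by (simp add: c_def d_op_relation_iff diff_act_normalized_coeff_eq_0_iff)
  also have "\<dots> \<longleftrightarrow>
      (\<forall>u\<in>?L. \<forall>u'\<in>?L. ?I u = ?I u' \<longrightarrow> c u = c u') \<and>
      (\<forall>I\<in>neg_supps A v\<^sub>0. \<forall>i. ?e i \<bullet>\<^sub>y cI I = 0) \<and>
      (\<forall>I\<in>neg_supps A v\<^sub>0. \<forall>I'\<in>neg_supps A v\<^sub>0.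
        mvar_prod (I' - I) \<bullet>\<^sub>y cI I - mvar_prod (I - I') \<bullet>\<^sub>y cI I' = 0)"
    (is "?rel \<and> ?eul \<longleftrightarrow> ?const \<and> ?R")
  proof -
    \<comment> \<open>Equal negative supports leave empty products of variables, which act as the
      identity.\<close>
    have "?rel \<Longrightarrow> ?const"
    proof (intro ballI impI)
      fix u u' assume ?rel "u \<in> ?L" "u' \<in> ?L" "?I u = ?I u'"
      then have "mvar_prod (?I u' - ?I u) \<bullet>\<^sub>y c u = mvar_prod (?I u - ?I u') \<bullet>\<^sub>y c u'" by blast
      then show "c u = c u'" by (simp add: \<open>?I u = ?I u'\<close> mvar_prod_def)
    qed
    moreover have "?rel \<and> ?eul \<longleftrightarrow> ?R" if ?const
    proof -
      \<comment> \<open>Under \<open>?const\<close> the representative chosen by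
        \<open>coeff_at\<close> is immaterial.\<close>
      have at: "cI (?I u) = c u" if "u \<in> ?L" for u
      proof -
        have "?I u \<in> neg_supps A v\<^sub>0" using that by (simp add: neg_supps_def)
        then obtain u' where "u' \<in> ?L" "?I u' = ?I u" "cI (?I u) = c u'"
          unfolding cI_def by (rule coeff_at_cases)
        then show ?thesis using \<open>?const\<close> that by metis
      qed
      show ?thesis unfolding neg_supps_def by (auto simp: at)
    qed
    ultimately show ?thesis by blast
  qed
  finally have main: "annihilated_by (phi_series A v\<^sub>0 N r) (hypergeometric_ideal A \<beta>) \<longleftrightarrow> \<dots>" .
  \<comment> \<open>Outside \<open>N\<close> the coefficient \<open>r u\<close> is zero, and with
    \<open>q = 1\<close> this carries over to the normalized coefficient.\<close>
  have "cI I = 0" if "I \<in> neg_supps A v\<^sub>0 - N" for I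
  proof -
    from that obtain u where "u \<in> ?L" "?I u = I" "cI I = c u"
      unfolding cI_def using coeff_at_cases by blast
    then show ?thesis
      using that r0 diff_act_normalized_coeff_eq_0_iff[of 1 v\<^sub>0 r u] by (simp add: c_def)
  qed
  with main show ?thesis by blast
qed

end
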